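(* Let $\mathcal{J}:\mathfrak{g}_2\to\mathfrak{g}_2$ be the Samelson complex structure on $\mathfrak{g}_2=\mathrm{Lie}(G_2)$ defined in the context on the basis $b_1,\dots,b_{14}$. Let $a_1,a_2,a_3\in\mathbb{R}$ satisfy $$0<a_2<a_1,\qquad \gamma<a_3<4a_1-3a_2,\qquad \text{where }\gamma:=\max\{3a_2-2a_1,\ a_1-3a_2,\ 0\},$$ and let $g=g_{a_1,a_2,a_3}$ be the symmetric bilinear form on $\mathfrak{g}_2$ whose nonzero components with respect to $b_1,\dots,b_{14}$ (all components that are neither listed nor obtained from a listed one by symmetry being zero) are $$g(b_1,b_1)=g(b_{12},b_{12})=\tfrac{2a_1-3a_2+a_3}{12},\qquad g(b_1,b_{12})=-\tfrac{2a_1-3a_2+a_3}{24},$$ $$g(b_2,b_2)=g(b_4,b_4)=\tfrac{2a_1+3a_2+a_3}{24},\qquad g(b_2,b_{14})=g(b_4,b_{13})=-\tfrac{-a_1+3a_2+a_3}{12},$$ $$g(b_3,b_3)=g(b_7,b_7)=\tfrac12 a_2,\qquad g(b_3,b_9)=-\tfrac14 a_2,\qquad g(b_7,b_8)=\tfrac14 a_2,$$ $$g(b_5,b_5)=g(b_6,b_6)=\tfrac{4a_1-3a_2-a_3}{12},\qquad g(b_5,b_{11})=-\tfrac{4a_1-3a_2-a_3}{24},\qquad g(b_6,b_{10})=\tfrac{4a_1-3a_2-a_3}{24},$$ $$g(b_8,b_8)=g(b_9,b_9)=\tfrac18(a_2+a_3),\qquad g(b_{10},b_{10})=g(b_{11},b_{11})=\tfrac{2a_1+3a_2+a_3}{24},$$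 $$g(b_{13},b_{13})=g(b_{14},b_{14})=\tfrac{-a_1+3a_2+a_3}{6}.$$ Then: (1) $(g,\mathcal{J})$ determines a left-invariant SKT structure on $G_2$; (2) the left-invariant metric determined by $g$ is invariant under the right action of the maximal torus $T\subset G_2$ whose Lie algebra is $\mathfrak{t}:=\mathrm{span}_{\mathbb{R}}\{b_1,b_{12}\}$; (3) for $\lambda>0$, $g=-\lambda K$, where $K$ is the Killing form of $\mathfrak{g}_2$, if and only if $a_1=96\lambda$, $a_2=32\lambda$, $a_3=96\lambda$. Conversely, if $h$ is any left-invariant $\mathcal{J}$-Hermitian metric on $G_2$ such that $(h,\mathcal{J})$ is SKT and $h$ is invariant under the right action of $T$, then (at the identity) $h=g_{a_1,a_2,a_3}$ for some $a_1,a_2,a_3\in\mathbb{R}$ satisfying $0<a_2<a_1$ and $\max\{3a_2-2a_1,\ a_1-3a_2,\ 0\}<a_3<4a_1-3a_2$.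
   Context: **The group.** Let $e^1,\dots,e^7$ be the dual of the standard basis of $\mathbb{R}^7$, $e^{ijk}:=e^i\wedge e^j\wedge e^k$, and $\phi:=e^{147}+e^{257}+e^{367}+e^{123}-e^{156}+e^{246}-e^{345}$. $G_2$ is the Lie group of linear maps $F:\mathbb{R}^7\to\mathbb{R}^7$ with $F^*\phi=\phi$; it is a compact Lie subgroup of $SO(7)$. Its Lie algebra $\mathfrak{g}_2\subset\mathfrak{so}(7)$ (with the commutator bracket) is 14-dimensional. Let $E_{ij}$ ($i<j$) be the $7\times7$ matrix with $(i,j)$-entry $1$, $(j,i)$-entry $-1$ and all other entries $0$. A basis of $\mathfrak{g}_2$ is $b_1=E_{12}-E_{67}$, $b_2=E_{13}+E_{46}$, $b_3=E_{17}-E_{26}$, $b_4=E_{23}-E_{47}$, $b_5=E_{24}+E_{15}$, $b_6=E_{25}-E_{14}$, $b_7=E_{27}+E_{16}$, $b_8=E_{34}+E_{16}$, $b_9=E_{35}+E_{26}$, $b_{10}=E_{36}-E_{14}$, $b_{11}=E_{37}-E_{15}$, $b_{12}=E_{45}+E_{67}$, $b_{13}=E_{56}+E_{47}$, $b_{14}=E_{57}-E_{46}$. **The complex structure.** $\mathcal{J}:\mathfrak{g}_2\to\mathfrak{g}_2$ is the linear map with $\mathcal{J}b_1=-\frac1{\sqrt3}b_1-\frac2{\sqrt3}b_{12}$, $\mathcal{J}b_2=-b_4$, $\mathcal{J}b_3=-b_7$, $\mathcal{J}b_4=b_2$, $\mathcal{J}b_5=-b_6$, $\mathcal{J}b_6=b_5$,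 $\mathcal{J}b_7=b_3$, $\mathcal{J}b_8=b_3+b_9$, $\mathcal{J}b_9=b_7-b_8$, $\mathcal{J}b_{10}=b_5+b_{11}$, $\mathcal{J}b_{11}=b_6-b_{10}$, $\mathcal{J}b_{12}=\frac2{\sqrt3}b_1+\frac1{\sqrt3}b_{12}$, $\mathcal{J}b_{13}=b_{14}$, $\mathcal{J}b_{14}=-b_{13}$. It satisfies $\mathcal{J}^2=-\mathrm{id}$ and has vanishing Nijenhuis tensor $N_{\mathcal{J}}(X,Y)=\mathcal{J}[\mathcal{J}X,Y]+\mathcal{J}[X,\mathcal{J}Y]+[X,Y]-[\mathcal{J}X,\mathcal{J}Y]$, so by left translation it defines a left-invariant integrable almost complex structure on $G_2$, denoted by the same symbol. **Conventions.** $\mathfrak{g}_2$ is identified with the tangent space at the identity and with the left-invariant vector fields. Inner products (positive definite symmetric bilinear forms) on $\mathfrak{g}_2$ are identified with left-invariant Riemannian metrics on $G_2$. A metric $g$ is $\mathcal{J}$-Hermitian if $g(\mathcal{J}\cdot,\mathcal{J}\cdot)=g(\cdot,\cdot)$; its fundamental form is $\omega:=g(\mathcal{J}\cdot,\cdot)$. The pair $(g,\mathcal{J})$ is an SKT (pluriclosed) structure if $g$ is a $\mathcal{J}$-Hermitian Riemannian metric and $\partial\overline{\partial}\omega=0$. The Killing form is $K(X,Y)=\mathrm{tr}(\mathrm{ad}_X\circ\mathrm{ad}_Y)$. *)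

theory Defs
  imports "HOL-Analysis.Analysis" "HOL-Library.Numeral_Type"
begin

section \<open>Matrix groups and their tangent spaces\<close>

definition matrix_group :: "(real^'n^'n) set \<Rightarrow> bool" where
  "matrix_group G \<longleftrightarrow>
     mat 1 \<in> G \<and> (\<forall>A\<in>G. \<forall>B\<in>G. A ** B \<in> G) \<and>
     (\<forall>A\<in>G. \<exists>B\<in>G. A ** B = mat 1 \<and> B ** A = mat 1)"

text \<open>
  The tangent space of a subset of matrix space, as the set of velocities of curves in it that
  are differentiable at time 0. The notion is used for closed matrix groups only; these are
  embedded submanifolds, so that asking for smoother curves would give the same vectors.
\<close>
definition tangent_space :: "(real^'n^'n) set \<Rightarrow> real^'n^'n \<Rightarrow> (real^'n^'n) set" where
  "tangent_space G F =
     {V. \<exists>c :: real \<Rightarrow> real^'n^'n.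
           (\<forall>s. c s \<in> G) \<and> c 0 = F \<and> (c has_vector_derivative V) (at 0)}"

definition lie_algebra :: "(real^'n^'n) set \<Rightarrow> (real^'n^'n) set" where
  "lie_algebra G = tangent_space G (mat 1)"

definition commutator :: "'a::ring_1^'n^'n \<Rightarrow> 'a^'n^'n \<Rightarrow> 'a^'n^'n" where
  "commutator A B = A ** B - B ** A"

definition torus :: "(real^'n^'n) set \<Rightarrow> bool" where
  "torus S \<longleftrightarrow>
     matrix_group S \<and> compact S \<and> connected S \<and> (\<forall>A\<in>S. \<forall>B\<in>S. A ** B = B ** A)"

definition maximal_torus :: "(real^'n^'n) set \<Rightarrow> (real^'n^'n) set \<Rightarrow> bool" where
  "maximal_torus G S \<longleftrightarrow>
     torus S \<and> S \<subseteq> G \<and> (\<forall>S'. torus S' \<and> S' \<subseteq> G \<and> S \<subseteq> S' \<longrightarrow> S' = S)"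


section \<open>Left-invariant metrics\<close>

text \<open>
  In this section and the next, \<open>\<gg>\<close> is the Lie algebra of a matrix group. Endomorphisms
  of and bilinear forms on \<open>\<gg>\<close> are functions on all matrices, of which only the values
  on \<open>\<gg>\<close> matter.
\<close>

definition bilinear_form_on :: "(real^'n^'n) set \<Rightarrow> (real^'n^'n \<Rightarrow> real^'n^'n \<Rightarrow> real) \<Rightarrow> bool" where
  "bilinear_form_on \<gg> g \<longleftrightarrow>
     (\<forall>X\<in>\<gg>. \<forall>Y\<in>\<gg>. \<forall>Z\<in>\<gg>. g (X + Y) Z = g X Z + g Y Z \<and> g Z (X + Y) = g Z X + g Z Y) \<and>
     (\<forall>c. \<forall>X\<in>\<gg>. \<forall>Y\<in>\<gg>. g (c *\<^sub>R X) Y = c * g X Y \<and> g X (c *\<^sub>R Y) = c * g X Y)"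

definition inner_product_on :: "(real^'n^'n) set \<Rightarrow> (real^'n^'n \<Rightarrow> real^'n^'n \<Rightarrow> real) \<Rightarrow> bool" where
  "inner_product_on \<gg> g \<longleftrightarrow>
     bilinear_form_on \<gg> g \<and> (\<forall>X\<in>\<gg>. \<forall>Y\<in>\<gg>. g X Y = g Y X) \<and> (\<forall>X\<in>\<gg>. X \<noteq> 0 \<longrightarrow> g X X > 0)"

text \<open>
  The left-invariant tensor with value \<open>g\<close> at the identity, evaluated at the point \<open>F\<close>
  on tangent vectors \<open>U\<close>, \<open>V\<close>: the differential of left translation by a matrix is left
  multiplication by it.
\<close>
definition left_invariant_metric ::
  "(real^'n^'n \<Rightarrow> real^'n^'n \<Rightarrow> real) \<Rightarrow> real^'n^'n \<Rightarrow> real^'n^'n \<Rightarrow> real^'n^'n \<Rightarrow> real" where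
  "left_invariant_metric g F U V = g (matrix_inv F ** U) (matrix_inv F ** V)"

definition right_invariant_under ::
  "(real^'n^'n) set \<Rightarrow> (real^'n^'n) set \<Rightarrow>
   (real^'n^'n \<Rightarrow> real^'n^'n \<Rightarrow> real^'n^'n \<Rightarrow> real) \<Rightarrow> bool" where
  "right_invariant_under G S m \<longleftrightarrow>
     (\<forall>A\<in>S. \<forall>F\<in>G. \<forall>U\<in>tangent_space G F. \<forall>V\<in>tangent_space G F.
        m (F ** A) (U ** A) (V ** A) = m F U V)"


section \<open>Left-invariant differential forms and SKT structures\<close>

text \<open>
  A complex-valued left-invariant \<open>k\<close>-form is an alternating complex-multilinear form on
  \<open>\<gg> \<otimes> \<complex> = \<gg> + \<i> \<gg>\<close>, represented as a function of a list of \<open>k\<close> complex matrices.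
\<close>
type_synonym 'n cform = "(complex^'n^'n) list \<Rightarrow> complex"

definition complexification :: "(real^'n^'n) set \<Rightarrow> (complex^'n^'n) set" where
  "complexification \<gg> = {Z. map_matrix Re Z \<in> \<gg> \<and> map_matrix Im Z \<in> \<gg>}"

definition complexify_endo :: "(real^'n^'n \<Rightarrow> real^'n^'n) \<Rightarrow> complex^'n^'n \<Rightarrow> complex^'n^'n" where
  "complexify_endo J Z =
     (\<chi> r s. Complex (J (map_matrix Re Z) $ r $ s) (J (map_matrix Im Z) $ r $ s))"

definition complexify_form :: "(real^'n^'n \<Rightarrow> real^'n^'n \<Rightarrow> real) \<Rightarrow> 'n cform" where
  "complexify_form w Zs =
     (let X1 = map_matrix Re (Zs ! 0); Y1 = map_matrix Im (Zs ! 0);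
          X2 = map_matrix Re (Zs ! 1); Y2 = map_matrix Im (Zs ! 1)
      in Complex (w X1 X2 - w Y1 Y2) (w X1 Y2 + w Y1 X2))"

text \<open>
  The exterior derivative of a left-invariant form (on left-invariant vector fields):
  in the invariant formula for the exterior derivative only the bracket terms remain.
\<close>
definition ext_deriv :: "'n::finite cform \<Rightarrow> 'n cform" where
  "ext_deriv \<alpha> Zs =
     (\<Sum>j<length Zs. \<Sum>i<j.
        (-1) ^ (i + j) * \<alpha> (commutator (Zs ! i) (Zs ! j) # nths Zs (- {i, j})))"

text \<open>The projections to the eigenspaces of \<open>J\<close> for \<open>\<i>\<close> and \<open>- \<i>\<close>.\<close>
definition proj10 :: "(real^'n^'n \<Rightarrow> real^'n^'n) \<Rightarrow> complex^'n^'n \<Rightarrow> complex^'n^'n" where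
  "proj10 J Z = (\<chi> r s. (Z $ r $ s - \<i> * complexify_endo J Z $ r $ s) / 2)"

definition proj01 :: "(real^'n^'n \<Rightarrow> real^'n^'n) \<Rightarrow> complex^'n^'n \<Rightarrow> complex^'n^'n" where
  "proj01 J Z = (\<chi> r s. (Z $ r $ s + \<i> * complexify_endo J Z $ r $ s) / 2)"

text \<open>
  The component of type \<open>(p, q)\<close> of a \<open>(p + q)\<close>-form: expand each argument as the sum of its
  two projections and keep the terms with exactly \<open>p\<close> arguments of type \<open>(1, 0)\<close>.
\<close>
definition type_part :: "(real^'n^'n \<Rightarrow> real^'n^'n) \<Rightarrow> nat \<Rightarrow> nat \<Rightarrow> 'n cform \<Rightarrow> 'n cform" where
  "type_part J p q \<alpha> Zs =
     (\<Sum>S | S \<subseteq> {..<p + q} \<and> card S = p.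
        \<alpha> (map (\<lambda>i. if i \<in> S then proj10 J (Zs ! i) else proj01 J (Zs ! i)) [0..<p + q]))"

text \<open>\<open>\<partial>\<close> and its conjugate on forms of type \<open>(p, q)\<close>.\<close>
definition del :: "(real^'n^'n \<Rightarrow> real^'n^'n) \<Rightarrow> nat \<Rightarrow> nat \<Rightarrow> 'n::finite cform \<Rightarrow> 'n cform" where
  "del J p q \<alpha> = type_part J (p + 1) q (ext_deriv \<alpha>)"

definition delbar :: "(real^'n^'n \<Rightarrow> real^'n^'n) \<Rightarrow> nat \<Rightarrow> nat \<Rightarrow> 'n::finite cform \<Rightarrow> 'n cform" where
  "delbar J p q \<alpha> = type_part J p (q + 1) (ext_deriv \<alpha>)"

definition hermitian_metric_on ::
  "(real^'n^'n) set \<Rightarrow> (real^'n^'n \<Rightarrow> real^'n^'n) \<Rightarrow> (real^'n^'n \<Rightarrow> real^'n^'n \<Rightarrow> real) \<Rightarrow> bool" where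
  "hermitian_metric_on \<gg> J g \<longleftrightarrow>
     inner_product_on \<gg> g \<and> (\<forall>X\<in>\<gg>. \<forall>Y\<in>\<gg>. g (J X) (J Y) = g X Y)"

definition fundamental_form ::
  "(real^'n^'n \<Rightarrow> real^'n^'n) \<Rightarrow> (real^'n^'n \<Rightarrow> real^'n^'n \<Rightarrow> real) \<Rightarrow>
   real^'n^'n \<Rightarrow> real^'n^'n \<Rightarrow> real" where
  "fundamental_form J g X Y = g (J X) Y"

text \<open>The fundamental form of a Hermitian metric has type \<open>(1, 1)\<close>.\<close>
definition skt_on ::
  "(real^'n^'n) set \<Rightarrow> (real^'n^'n \<Rightarrow> real^'n^'n) \<Rightarrow>
   (real^'n::finite^'n \<Rightarrow> real^'n^'n \<Rightarrow> real) \<Rightarrow> bool" where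
  "skt_on \<gg> J g \<longleftrightarrow>
     hermitian_metric_on \<gg> J g \<and>
     (\<forall>Zs. length Zs = 4 \<and> set Zs \<subseteq> complexification \<gg> \<longrightarrow>
        del J 1 2 (delbar J 1 1 (complexify_form (fundamental_form J g))) Zs = 0)"


section \<open>The group \<open>G\<^sub>2\<close> and its Lie algebra\<close>

text \<open>
  Coordinates on \<open>\<real>\<^sup>7\<close> are indexed by the numeral type \<open>7\<close>, whose elements are
  1, 2, 3, 4, 5, 6 and 7 = 0.
\<close>

definition e3 :: "7 \<Rightarrow> 7 \<Rightarrow> 7 \<Rightarrow> real^7 \<Rightarrow> real^7 \<Rightarrow> real^7 \<Rightarrow> real" where
  "e3 i j k u v w =
     det (vector [vector [u $ i, u $ j, u $ k],
                  vector [v $ i, v $ j, v $ k],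
                  vector [w $ i, w $ j, w $ k]] :: real^3^3)"

definition phi :: "real^7 \<Rightarrow> real^7 \<Rightarrow> real^7 \<Rightarrow> real" where
  "phi u v w =
     e3 1 4 7 u v w + e3 2 5 7 u v w + e3 3 6 7 u v w + e3 1 2 3 u v w
     - e3 1 5 6 u v w + e3 2 4 6 u v w - e3 3 4 5 u v w"

definition G2 :: "(real^7^7) set" where
  "G2 = {F. \<forall>u v w. phi (F *v u) (F *v v) (F *v w) = phi u v w}"

definition E :: "7 \<Rightarrow> 7 \<Rightarrow> real^7^7" where
  "E i j = (\<chi> r s. if r = i \<and> s = j then 1 else if r = j \<and> s = i then -1 else 0)"

definition bas :: "nat \<Rightarrow> real^7^7" where
  "bas i =
     [E 1 2 - E 6 7, E 1 3 + E 4 6, E 1 7 - E 2 6, E 2 3 - E 4 7, E 2 4 + E 1 5,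
      E 2 5 - E 1 4, E 2 7 + E 1 6, E 3 4 + E 1 6, E 3 5 + E 2 6, E 3 6 - E 1 4,
      E 3 7 - E 1 5, E 4 5 + E 6 7, E 5 6 + E 4 7, E 5 7 - E 4 6] ! (i - 1)"

definition coord :: "nat \<Rightarrow> real^7^7 \<Rightarrow> real" where
  "coord i X = representation (bas ` {1..14}) X (bas i)"

definition killing_form :: "real^7^7 \<Rightarrow> real^7^7 \<Rightarrow> real" where
  "killing_form X Y = (\<Sum>i = 1..14. coord i (commutator X (commutator Y (bas i))))"

definition samelson_J :: "real^7^7 \<Rightarrow> real^7^7" where
  "samelson_J X =
     (\<Sum>i = 1..14. coord i X *\<^sub>R
        ([- (1 / sqrt 3) *\<^sub>R bas 1 - (2 / sqrt 3) *\<^sub>R bas 12,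
          - bas 4, - bas 7, bas 2, - bas 6, bas 5, bas 3,
          bas 3 + bas 9, bas 7 - bas 8, bas 5 + bas 11, bas 6 - bas 10,
          (2 / sqrt 3) *\<^sub>R bas 1 + (1 / sqrt 3) *\<^sub>R bas 12,
          bas 14, - bas 13] ! (i - 1)))"


section \<open>The metrics \<open>g\<close>\<close>

definition admissible :: "real \<Rightarrow> real \<Rightarrow> real \<Rightarrow> bool" where
  "admissible a1 a2 a3 \<longleftrightarrow>
     0 < a2 \<and> a2 < a1 \<and>
     Max {3 * a2 - 2 * a1, a1 - 3 * a2, 0} < a3 \<and> a3 < 4 * a1 - 3 * a2"

definition gcomp_upper :: "real \<Rightarrow> real \<Rightarrow> real \<Rightarrow> nat \<Rightarrow> nat \<Rightarrow> real" where
  "gcomp_upper a1 a2 a3 i j =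
     (if (i, j) \<in> {(1, 1), (12, 12)} then (2 * a1 - 3 * a2 + a3) / 12
      else if (i, j) = (1, 12) then - (2 * a1 - 3 * a2 + a3) / 24
      else if (i, j) \<in> {(2, 2), (4, 4)} then (2 * a1 + 3 * a2 + a3) / 24
      else if (i, j) \<in> {(2, 14), (4, 13)} then - (- a1 + 3 * a2 + a3) / 12
      else if (i, j) \<in> {(3, 3), (7, 7)} then a2 / 2
      else if (i, j) = (3, 9) then - a2 / 4
      else if (i, j) = (7, 8) then a2 / 4
      else if (i, j) \<in> {(5, 5), (6, 6)} then (4 * a1 - 3 * a2 - a3) / 12
      else if (i, j) = (5, 11) then - (4 * a1 - 3 * a2 - a3) / 24
      else if (i, j) = (6, 10) then (4 * a1 - 3 * a2 - a3) / 24
      else if (i, j) \<in> {(8, 8), (9, 9)} then (a2 + a3) / 8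
      else if (i, j) \<in> {(10, 10), (11, 11)} then (2 * a1 + 3 * a2 + a3) / 24
      else if (i, j) \<in> {(13, 13), (14, 14)} then (- a1 + 3 * a2 + a3) / 6
      else 0)"

definition gmetric :: "real \<Rightarrow> real \<Rightarrow> real \<Rightarrow> real^7^7 \<Rightarrow> real^7^7 \<Rightarrow> real" where
  "gmetric a1 a2 a3 X Y =
     (\<Sum>i = 1..14. \<Sum>j = 1..14.
        gcomp_upper a1 a2 a3 (min i j) (max i j) * coord i X * coord j Y)"

end

theory Submission
  imports Defs
begin

text \<open>
  Write \<open>[X, Y]\<close> for the commutator. Every metric of the family has fundamental form
  \<open>\<omega>(X, Y) = - \<mu> tr (JX Y) + tr (K [X, Y])\<close> with \<open>K\<close> in the Lie algebra of the torus, i.e. it is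
  a multiple of the fundamental form of the Killing form plus an exact form. So its exterior
  derivative is that of the bi-invariant metric, which is SKT because \<open>J\<close> is integrable.
  Elements of the torus commute with \<open>b\<^sub>1\<close> and \<open>b\<^sub>1\<^sub>2\<close>, hence preserve the root planes, on each of
  which \<open>J\<close> is a multiple of \<open>ad (b\<^sub>1 + 4 b\<^sub>1\<^sub>2)\<close>; so they commute with \<open>J\<close> and preserve \<open>\<omega>\<close>.
  Conversely, differentiating the invariance along the torus makes the root planes orthogonal, so
  that an invariant Hermitian metric has seven free weights (six root planes and the torus), and
  \<open>\<partial>\<close> of the conjugate \<open>\<partial>\<close> of \<open>\<omega>\<close> at four quadruples of root vectors
  \<open>(e\<^sub>k, e\<^sub>l, f\<^sub>k, f\<^sub>l)\<close>, with \<open>f\<^sub>k\<close> conjugate to \<open>e\<^sub>k\<close>, gives four independent linear relations between them.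
\<close>

section \<open>Coordinates on the Lie algebra\<close>

text \<open>The Cartan 3-form H(X,Y,Z) = tr([X,Y] Z) is closed, and the eigenspaces of
  \<open>J\<close> are isotropic subalgebras. Hence, up to a factor, d \<omega> is the difference of
  the parts of H of types (2,1) and (1,2), and the (2,2) part of d of the latter is half of dH. In
  the converse, four relations between seven weights leave three parameters; the inequalities on
  them say exactly that all seven weights are positive, \<open>a2 < a1\<close> being the positivity
  of the sum of weights 0 and 5. Two obstacles shape the analysis. Tangent vectors come from curves
  that are differentiable at time 0 only, and \<open>h\<close> is known only on the Lie algebra. So
  one-parameter groups are written down explicitly, inverses are differentiated by an estimate
  resting on compactness of the torus, and bilinear forms are differentiated in coordinates.
  Coordinates are kept over an arbitrary ring, so that bracket and trace are computed once for the
  real Lie algebra and its complexification.\<close>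

declare One_nat_def [simp del]

lemma exhaust_7:
  fixes x :: 7
  shows "x = 1 \<or> x = 2 \<or> x = 3 \<or> x = 4 \<or> x = 5 \<or> x = 6 \<or> x = 7"
proof (induct x)
  case (of_int z)
  then have "z = 0 \<or> z = 1 \<or> z = 2 \<or> z = 3 \<or> z = 4 \<or> z = 5 \<or> z = 6" by fastforce
  then show ?case by auto
qed

lemma forall_7: "(\<forall>i::7. P i) \<longleftrightarrow> P 1 \<and> P 2 \<and> P 3 \<and> P 4 \<and> P 5 \<and> P 6 \<and> P 7"
  by (metis exhaust_7)

lemma UNIV_7: "UNIV = {1, 2, 3, 4, 5, 6, 7::7}"
  using exhaust_7 by auto

lemma sum_7: "sum f (UNIV::7 set) = f 1 + f 2 + f 3 + f 4 + f 5 + f 6 + f 7"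
  unfolding UNIV_7 by (simp add: ac_simps)

lemma vector_7:
  "(vector [a,b,c,d,e,f,g] :: 'a::zero^7) $ 1 = a"
  "(vector [a,b,c,d,e,f,g] :: 'a::zero^7) $ 2 = b"
  "(vector [a,b,c,d,e,f,g] :: 'a::zero^7) $ 3 = c"
  "(vector [a,b,c,d,e,f,g] :: 'a::zero^7) $ 4 = d"
  "(vector [a,b,c,d,e,f,g] :: 'a::zero^7) $ 5 = e"
  "(vector [a,b,c,d,e,f,g] :: 'a::zero^7) $ 6 = f"
  "(vector [a,b,c,d,e,f,g] :: 'a::zero^7) $ 7 = g"
  unfolding vector_def by simp_all

lemma matrix_eq_7: "(A :: 'a^7^7) = B \<longleftrightarrow> (\<forall>i j. A $ i $ j = B $ i $ j)"
  by (simp add: vec_eq_iff)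

text \<open>The element with coordinates \<open>x 1, \<dots>, x 14\<close> in the basis \<open>bas\<close>, over any
  coefficient ring; the other values of \<open>x\<close> are irrelevant.\<close>
definition g2mat :: "(nat \<Rightarrow> 'a::comm_ring_1) \<Rightarrow> 'a^7^7" where
  "g2mat x = vector
    [vector [0, x 1, x 2, - x 6 - x 10, x 5 - x 11, x 7 + x 8, x 3],
     vector [- x 1, 0, x 4, x 5, x 6, - x 3 + x 9, x 7],
     vector [- x 2, - x 4, 0, x 8, x 9, x 10, x 11],
     vector [x 6 + x 10, - x 5, - x 8, 0, x 12, x 2 - x 14, - x 4 + x 13],
     vector [- x 5 + x 11, - x 6, - x 9, - x 12, 0, x 13, x 14],
     vector [- x 7 - x 8, x 3 - x 9, - x 10, - x 2 + x 14, - x 13, 0, - x 1 + x 12],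
     vector [- x 3, - x 7, - x 11, x 4 - x 13, - x 14, x 1 - x 12, 0]]"

text \<open>The structure constants of the Lie algebra. As the bracket is alternating, only the
  2-by-2 minors \<open>w i j\<close> of the two coordinate vectors enter.\<close>

definition g2bracket :: "(nat \<Rightarrow> 'a::comm_ring_1) \<Rightarrow> (nat \<Rightarrow> 'a) \<Rightarrow> nat \<Rightarrow> 'a" where
  "g2bracket x y k =
     (let w = (\<lambda>i j. x i * y j - x j * y i)
      in [- w 2 4 - 2 * w 3 7 - w 3 8 - 2 * w 5 6 - w 5 10 - w 6 11 - w 7 9 - w 8 9,
       w 1 4 - w 3 11 - w 5 9 + w 6 8 - w 7 10 - 2 * w 8 10 - w 9 11,
       2 * w 1 7 + w 1 8 + w 2 11 - w 4 6 - w 4 10 + w 5 14 - w 6 13 + w 7 12 + w 8 12 - w 10 13 - w 11 14,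
       - w 1 2 + w 3 10 - w 5 8 - w 6 9 - w 7 11 - w 9 10,
       w 1 6 + w 1 10 - w 2 3 + w 2 9 - w 3 14 - w 4 7 + w 4 8 - w 6 12 - w 7 13 + w 9 14,
       - w 1 5 + w 1 11 + w 3 13 + w 4 9 + w 5 12 - w 7 14 - w 9 13,
       - 2 * w 1 3 + w 1 9 - w 3 12 + w 4 5 + w 4 11 + w 5 13 + w 6 14 + w 9 12,
       w 2 6 + 2 * w 2 10 - w 4 5 - w 4 11 - w 9 12 + w 10 14 - w 11 13,
       - w 2 5 + w 2 11 - w 4 6 + w 8 12 - w 10 13 - w 11 14,
       - w 1 11 - w 2 7 - 2 * w 2 8 - w 3 4 - w 4 9 - w 8 14 + w 9 13 - w 11 12,
       w 1 10 - w 2 3 - w 4 7 + w 4 8 + w 8 13 + w 9 14 + w 10 12,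
       - w 2 13 + w 4 14 - 2 * w 5 6 - w 5 10 - w 6 11 - w 8 9 - w 10 11 - 2 * w 13 14,
       - w 1 14 + w 2 12 - w 3 6 - w 5 7 - w 5 8 - w 6 9 - w 7 11 - w 8 11 - w 9 10 + 2 * w 12 14,
       w 1 13 + w 3 5 - w 3 11 - w 4 12 - w 6 7 - w 9 11 - 2 * w 12 13] ! (k - 1))"

lemma g2mat_nth:
  "g2mat x $ 1 $ 1 = 0" "g2mat x $ 1 $ 2 = x 1" "g2mat x $ 1 $ 3 = x 2" "g2mat x $ 1 $ 4 = - x 6 - x 10"
    "g2mat x $ 1 $ 5 = x 5 - x 11" "g2mat x $ 1 $ 6 = x 7 + x 8" "g2mat x $ 1 $ 7 = x 3"
  "g2mat x $ 2 $ 1 = - x 1" "g2mat x $ 2 $ 2 = 0" "g2mat x $ 2 $ 3 = x 4" "g2mat x $ 2 $ 4 = x 5"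
    "g2mat x $ 2 $ 5 = x 6" "g2mat x $ 2 $ 6 = - x 3 + x 9" "g2mat x $ 2 $ 7 = x 7"
  "g2mat x $ 3 $ 1 = - x 2" "g2mat x $ 3 $ 2 = - x 4" "g2mat x $ 3 $ 3 = 0" "g2mat x $ 3 $ 4 = x 8"
    "g2mat x $ 3 $ 5 = x 9" "g2mat x $ 3 $ 6 = x 10" "g2mat x $ 3 $ 7 = x 11"
  "g2mat x $ 4 $ 1 = x 6 + x 10" "g2mat x $ 4 $ 2 = - x 5" "g2mat x $ 4 $ 3 = - x 8" "g2mat x $ 4 $ 4 = 0"
    "g2mat x $ 4 $ 5 = x 12" "g2mat x $ 4 $ 6 = x 2 - x 14" "g2mat x $ 4 $ 7 = - x 4 + x 13"
  "g2mat x $ 5 $ 1 = - x 5 + x 11" "g2mat x $ 5 $ 2 = - x 6" "g2mat x $ 5 $ 3 = - x 9" "g2mat x $ 5 $ 4 = - x 12"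
    "g2mat x $ 5 $ 5 = 0" "g2mat x $ 5 $ 6 = x 13" "g2mat x $ 5 $ 7 = x 14"
  "g2mat x $ 6 $ 1 = - x 7 - x 8" "g2mat x $ 6 $ 2 = x 3 - x 9" "g2mat x $ 6 $ 3 = - x 10" "g2mat x $ 6 $ 4 = - x 2 + x 14"
    "g2mat x $ 6 $ 5 = - x 13" "g2mat x $ 6 $ 6 = 0" "g2mat x $ 6 $ 7 = - x 1 + x 12"
  "g2mat x $ 7 $ 1 = - x 3" "g2mat x $ 7 $ 2 = - x 7" "g2mat x $ 7 $ 3 = - x 11" "g2mat x $ 7 $ 4 = x 4 - x 13"
    "g2mat x $ 7 $ 5 = - x 14" "g2mat x $ 7 $ 6 = x 1 - x 12" "g2mat x $ 7 $ 7 = 0"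
  unfolding g2mat_def vector_7 by (rule refl)+

lemma g2bracket_nth:
  fixes x y :: "nat \<Rightarrow> 'a::comm_ring_1"
  defines "w \<equiv> \<lambda>i j. x i * y j - x j * y i"
  shows
    "g2bracket x y 1 = - w 2 4 - 2 * w 3 7 - w 3 8 - 2 * w 5 6 - w 5 10 - w 6 11 - w 7 9 - w 8 9"
    "g2bracket x y 2 = w 1 4 - w 3 11 - w 5 9 + w 6 8 - w 7 10 - 2 * w 8 10 - w 9 11"
    "g2bracket x y 3 = 2 * w 1 7 + w 1 8 + w 2 11 - w 4 6 - w 4 10 + w 5 14
      - w 6 13 + w 7 12 + w 8 12 - w 10 13 - w 11 14"
    "g2bracket x y 4 = - w 1 2 + w 3 10 - w 5 8 - w 6 9 - w 7 11 - w 9 10"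
    "g2bracket x y 5 = w 1 6 + w 1 10 - w 2 3 + w 2 9 - w 3 14 - w 4 7 + w 4 8
      - w 6 12 - w 7 13 + w 9 14"
    "g2bracket x y 6 = - w 1 5 + w 1 11 + w 3 13 + w 4 9 + w 5 12 - w 7 14 - w 9 13"
    "g2bracket x y 7 = - 2 * w 1 3 + w 1 9 - w 3 12 + w 4 5 + w 4 11 + w 5 13 + w 6 14 + w 9 12"
    "g2bracket x y 8 = w 2 6 + 2 * w 2 10 - w 4 5 - w 4 11 - w 9 12 + w 10 14 - w 11 13"
    "g2bracket x y 9 = - w 2 5 + w 2 11 - w 4 6 + w 8 12 - w 10 13 - w 11 14"
    "g2bracket x y 10 = - w 1 11 - w 2 7 - 2 * w 2 8 - w 3 4 - w 4 9 - w 8 14 + w 9 13 - w 11 12"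
    "g2bracket x y 11 = w 1 10 - w 2 3 - w 4 7 + w 4 8 + w 8 13 + w 9 14 + w 10 12"
    "g2bracket x y 12 = - w 2 13 + w 4 14 - 2 * w 5 6 - w 5 10 - w 6 11 - w 8 9
      - w 10 11 - 2 * w 13 14"
    "g2bracket x y 13 = - w 1 14 + w 2 12 - w 3 6 - w 5 7 - w 5 8 - w 6 9 - w 7 11
      - w 8 11 - w 9 10 + 2 * w 12 14"
    "g2bracket x y 14 = w 1 13 + w 3 5 - w 3 11 - w 4 12 - w 6 7 - w 9 11 - 2 * w 12 13"
  by (simp_all add: g2bracket_def w_def)

lemma commutator_g2mat: "commutator (g2mat x) (g2mat y) = g2mat (g2bracket x y)"
  unfolding matrix_eq_7 forall_7
  by (intro conjI; simp only: commutator_def vector_minus_component matrix_matrix_mult_def sum_7 g2mat_nth g2bracket_nth vec_lambda_beta; simp add: algebra_simps)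

lemma atLeastAtMost_1_14: "{1..14} = {1, 2, 3, 4, 5, 6, 7, 8, 9, 10, 11, 12, 13, 14::nat}"
  by (rule set_eqI) (simp, arith)

lemma sum_1_14:
  "sum f {1..14::nat} = f 1 + f 2 + f 3 + f 4 + f 5 + f 6 + f 7
     + f 8 + f 9 + f 10 + f 11 + f 12 + f 13 + f 14"
  unfolding atLeastAtMost_1_14 by (simp add: ac_simps)

lemma ball_1_14:
  "(\<forall>k\<in>{1..14::nat}. P k) \<longleftrightarrow> P 1 \<and> P 2 \<and> P 3 \<and> P 4 \<and> P 5 \<and> P 6 \<and> P 7
     \<and> P 8 \<and> P 9 \<and> P 10 \<and> P 11 \<and> P 12 \<and> P 13 \<and> P 14"
  unfolding atLeastAtMost_1_14 by simp

lemma g2mat_eq_iff: "g2mat x = g2mat y \<longleftrightarrow> (\<forall>k\<in>{1..14}. x k = y k)"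
proof
  assume eq: "g2mat x = g2mat y"
  show "\<forall>k\<in>{1..14}. x k = y k"
    unfolding ball_1_14
    using arg_cong[OF eq, of "\<lambda>A. A $ 1 $ 2"] arg_cong[OF eq, of "\<lambda>A. A $ 1 $ 3"]
      arg_cong[OF eq, of "\<lambda>A. A $ 1 $ 7"] arg_cong[OF eq, of "\<lambda>A. A $ 2 $ 3"]
      arg_cong[OF eq, of "\<lambda>A. A $ 2 $ 4"] arg_cong[OF eq, of "\<lambda>A. A $ 2 $ 5"]
      arg_cong[OF eq, of "\<lambda>A. A $ 2 $ 7"] arg_cong[OF eq, of "\<lambda>A. A $ 3 $ 4"]
      arg_cong[OF eq, of "\<lambda>A. A $ 3 $ 5"] arg_cong[OF eq, of "\<lambda>A. A $ 3 $ 6"]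
      arg_cong[OF eq, of "\<lambda>A. A $ 3 $ 7"] arg_cong[OF eq, of "\<lambda>A. A $ 4 $ 5"]
      arg_cong[OF eq, of "\<lambda>A. A $ 5 $ 6"] arg_cong[OF eq, of "\<lambda>A. A $ 5 $ 7"]
    unfolding g2mat_nth by simp
next
  assume "\<forall>k\<in>{1..14}. x k = y k"
  then show "g2mat x = g2mat y"
    unfolding ball_1_14 by (simp add: g2mat_def)
qed

lemma g2mat_add: "g2mat x + g2mat y = g2mat (\<lambda>k. x k + y k)"
  unfolding matrix_eq_7 forall_7 vector_add_component g2mat_nth by simp

lemma g2mat_diff: "g2mat x - g2mat y = g2mat (\<lambda>k. x k - y k)"
  unfolding matrix_eq_7 forall_7 vector_minus_component g2mat_nth by simp

lemma g2mat_minus: "- g2mat x = g2mat (\<lambda>k. - x k)"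
  unfolding matrix_eq_7 forall_7 vector_uminus_component g2mat_nth by simp

lemma g2mat_0: "g2mat (\<lambda>k. 0) = 0"
  unfolding matrix_eq_7 forall_7 g2mat_nth by simp

lemma g2mat_scaleR: "c *\<^sub>R g2mat x = g2mat (\<lambda>k. c * x k)"
  unfolding matrix_eq_7 forall_7 vector_scaleR_component g2mat_nth by (simp add: algebra_simps)

lemma bas_eq_g2mat:
  assumes "k \<in> {1..14}"
  shows "bas k = g2mat (\<lambda>i. if i = k then 1 else 0)"
proof -
  have "\<forall>k\<in>{1..14}. bas k = g2mat (\<lambda>i. if i = k then 1 else 0)"
    unfolding ball_1_14 matrix_eq_7 forall_7 g2mat_nth by (simp add: bas_def E_def)
  then show ?thesis using assms by blast
qed

lemma bas_numeral:
  "bas 1 = g2mat (\<lambda>i. if i = 1 then 1 else 0)"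
  "bas 2 = g2mat (\<lambda>i. if i = 2 then 1 else 0)"
  "bas 3 = g2mat (\<lambda>i. if i = 3 then 1 else 0)"
  "bas 4 = g2mat (\<lambda>i. if i = 4 then 1 else 0)"
  "bas 5 = g2mat (\<lambda>i. if i = 5 then 1 else 0)"
  "bas 6 = g2mat (\<lambda>i. if i = 6 then 1 else 0)"
  "bas 7 = g2mat (\<lambda>i. if i = 7 then 1 else 0)"
  "bas 8 = g2mat (\<lambda>i. if i = 8 then 1 else 0)"
  "bas 9 = g2mat (\<lambda>i. if i = 9 then 1 else 0)"
  "bas 10 = g2mat (\<lambda>i. if i = 10 then 1 else 0)"
  "bas 11 = g2mat (\<lambda>i. if i = 11 then 1 else 0)"
  "bas 12 = g2mat (\<lambda>i. if i = 12 then 1 else 0)"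
  "bas 13 = g2mat (\<lambda>i. if i = 13 then 1 else 0)"
  "bas 14 = g2mat (\<lambda>i. if i = 14 then 1 else 0)"
  by (simp_all add: bas_eq_g2mat)

lemma sum_bas: "(\<Sum>k = 1..14. x k *\<^sub>R bas k) = g2mat x"
  unfolding sum_1_14 bas_numeral g2mat_scaleR g2mat_add g2mat_eq_iff ball_1_14 by simp

lemma inj_on_bas: "inj_on bas {1..14}"
  unfolding inj_on_def by (auto simp: bas_eq_g2mat g2mat_eq_iff split: if_splits)

lemma span_bas: "span (bas ` {1..14}) = range g2mat"
proof
  show "span (bas ` {1..14}) \<subseteq> range g2mat"
  proof (rule span_minimal)
    show "bas ` {1..14} \<subseteq> range g2mat"
      using bas_eq_g2mat by blast
    show "subspace (range (g2mat :: (nat \<Rightarrow> real) \<Rightarrow> _))"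
      unfolding subspace_def by (auto simp: g2mat_add g2mat_scaleR simp flip: g2mat_0)
  qed
  show "range g2mat \<subseteq> span (bas ` {1..14})"
    by (auto simp flip: sum_bas intro: span_sum[OF span_scale[OF span_base]])
qed

lemma independent_bas: "independent (bas ` {1..14})"
proof (rule independent_if_scalars_zero)
  fix f v assume sum: "(\<Sum>v\<in>bas ` {1..14}. f v *\<^sub>R v) = 0" and v: "v \<in> bas ` {1..14}"
  have "g2mat (\<lambda>k. f (bas k)) = g2mat (\<lambda>k. 0)"
    using sum by (simp add: sum.reindex[OF inj_on_bas] sum_bas g2mat_0)
  then show "f v = 0" using v by (auto simp: g2mat_eq_iff)
qed simp

lemma coord_g2mat:
  assumes "k \<in> {1..14}"
  shows "coord k (g2mat x) = x k"
proof -
  let ?y = "representation (bas ` {1..14}) (g2mat x)"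
  have "g2mat (\<lambda>k. ?y (bas k)) = (\<Sum>v\<in>bas ` {1..14}. ?y v *\<^sub>R v)"
    by (simp add: sum.reindex[OF inj_on_bas] sum_bas)
  also have "\<dots> = g2mat x"
    by (rule sum_representation_eq[OF independent_bas]) (simp_all add: span_bas)
  finally show ?thesis
    using assms unfolding coord_def g2mat_eq_iff by blast
qed

lemma coord_g2mat_numeral:
  "coord 1 (g2mat x) = x 1"
  "coord 2 (g2mat x) = x 2"
  "coord 3 (g2mat x) = x 3"
  "coord 4 (g2mat x) = x 4"
  "coord 5 (g2mat x) = x 5"
  "coord 6 (g2mat x) = x 6"
  "coord 7 (g2mat x) = x 7"
  "coord 8 (g2mat x) = x 8"
  "coord 9 (g2mat x) = x 9"
  "coord 10 (g2mat x) = x 10"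
  "coord 11 (g2mat x) = x 11"
  "coord 12 (g2mat x) = x 12"
  "coord 13 (g2mat x) = x 13"
  "coord 14 (g2mat x) = x 14"
  by (simp_all add: coord_g2mat)

text \<open>The complex structure in coordinates; \<open>r\<close> stands for \<open>1 / sqrt 3\<close>.\<close>
definition J_coords :: "'a::comm_ring_1 \<Rightarrow> (nat \<Rightarrow> 'a) \<Rightarrow> nat \<Rightarrow> 'a" where
  "J_coords r x k =
     [r * (2 * x 12 - x 1), x 4, x 7 + x 8, - x 2, x 6 + x 10, x 11 - x 5, x 9 - x 3,
      - x 9, x 8, - x 11, x 10, r * (x 12 - 2 * x 1), - x 14, x 13] ! (k - 1)"

lemma J_coords_nth:
  "J_coords r x 1 = r * (2 * x 12 - x 1)" "J_coords r x 2 = x 4" "J_coords r x 3 = x 7 + x 8"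
  "J_coords r x 4 = - x 2" "J_coords r x 5 = x 6 + x 10" "J_coords r x 6 = x 11 - x 5"
  "J_coords r x 7 = x 9 - x 3" "J_coords r x 8 = - x 9" "J_coords r x 9 = x 8"
  "J_coords r x 10 = - x 11" "J_coords r x 11 = x 10"
  "J_coords r x 12 = r * (x 12 - 2 * x 1)" "J_coords r x 13 = - x 14" "J_coords r x 14 = x 13"
  by (simp_all add: J_coords_def)

lemma samelson_J_g2mat: "samelson_J (g2mat x) = g2mat (J_coords (1 / sqrt 3) x)"
proof -
  have "samelson_J (g2mat x) = g2mat (\<lambda>k. J_coords (1 / sqrt 3) x k)"
    unfolding samelson_J_def sum_1_14 coord_g2mat_numeral
    by (simp add: bas_numeral g2mat_scaleR g2mat_add g2mat_diff g2mat_minus g2mat_eq_iff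
        ball_1_14 J_coords_nth algebra_simps)
  then show ?thesis .
qed

text \<open>The general form that is diagonal with respect to the root planes: \<open>q 0\<close>
  scales the inner product on the torus preserved by \<open>J\<close>, unique up to scale, and
  \<open>q 1\<close> to \<open>q 6\<close> scale the planes. The halves arise because not every
  basis vector is a root vector. Over the complex numbers this is the complex bilinear
  extension.\<close>

definition plane_form :: "(nat \<Rightarrow> 'a::field_char_0) \<Rightarrow> (nat \<Rightarrow> 'a) \<Rightarrow> (nat \<Rightarrow> 'a) \<Rightarrow> 'a" where
  "plane_form q x y =
     q 0 * (x 1 * y 1 + x 12 * y 12 - (x 1 * y 12 + x 12 * y 1) / 2)
     + q 1 * ((x 13 - x 4 / 2) * (y 13 - y 4 / 2) + (x 14 - x 2 / 2) * (y 14 - y 2 / 2))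
     + q 2 * (x 4 * y 4 + x 2 * y 2)
     + q 3 * ((x 7 + x 8 / 2) * (y 7 + y 8 / 2) + (x 3 - x 9 / 2) * (y 3 - y 9 / 2))
     + q 4 * (x 8 * y 8 + x 9 * y 9)
     + q 5 * ((x 6 + x 10 / 2) * (y 6 + y 10 / 2) + (x 5 - x 11 / 2) * (y 5 - y 11 / 2))
     + q 6 * (x 10 * y 10 + x 11 * y 11)"

text \<open>Found by completing squares in the components of the metric; for example the component
  at \<open>(2, 2)\<close> is a quarter of weight 1 plus weight 2.\<close>

definition gmetric_weights :: "real \<Rightarrow> real \<Rightarrow> real \<Rightarrow> nat \<Rightarrow> real" where
  "gmetric_weights a1 a2 a3 k =
     [(2 * a1 - 3 * a2 + a3) / 12, (- a1 + 3 * a2 + a3) / 6, a1 / 8, a2 / 2, a3 / 8,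
      (4 * a1 - 3 * a2 - a3) / 12, (3 * a2 + a3) / 16] ! k"

lemma gmetric_weights_nth:
  "gmetric_weights a1 a2 a3 0 = (2 * a1 - 3 * a2 + a3) / 12"
  "gmetric_weights a1 a2 a3 1 = (- a1 + 3 * a2 + a3) / 6"
  "gmetric_weights a1 a2 a3 2 = a1 / 8"
  "gmetric_weights a1 a2 a3 3 = a2 / 2"
  "gmetric_weights a1 a2 a3 4 = a3 / 8"
  "gmetric_weights a1 a2 a3 5 = (4 * a1 - 3 * a2 - a3) / 12"
  "gmetric_weights a1 a2 a3 6 = (3 * a2 + a3) / 16"
  by (simp_all add: gmetric_weights_def)

lemma gmetric_g2mat:
  "gmetric a1 a2 a3 (g2mat x) (g2mat y) = plane_form (gmetric_weights a1 a2 a3) x y"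
  unfolding gmetric_def sum_1_14 coord_g2mat_numeral
  by (simp add: gcomp_upper_def plane_form_def gmetric_weights_nth) (simp add: field_simps)

lemma trace_g2mat:
  "trace (g2mat x ** g2mat y) = - 2 * (
     2 * x 1 * y 1 - x 1 * y 12 + 2 * x 2 * y 2 - x 2 * y 14 + 2 * x 3 * y 3 - x 3 * y 9
     + 2 * x 4 * y 4 - x 4 * y 13 + 2 * x 5 * y 5 - x 5 * y 11 + 2 * x 6 * y 6 + x 6 * y 10
     + 2 * x 7 * y 7 + x 7 * y 8 + x 8 * y 7 + 2 * x 8 * y 8 - x 9 * y 3 + 2 * x 9 * y 9
     + x 10 * y 6 + 2 * x 10 * y 10 - x 11 * y 5 + 2 * x 11 * y 11 - x 12 * y 1
     + 2 * x 12 * y 12 - x 13 * y 4 + 2 * x 13 * y 13 - x 14 * y 2 + 2 * x 14 * y 14)"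
  unfolding trace_def matrix_matrix_mult_def vec_lambda_beta sum_7 g2mat_nth
  by (simp add: algebra_simps)

text \<open>Invariant forms on a simple Lie algebra are proportional; 4 is the factor for the
  7-dimensional representation. It comes out here by expanding both sides.\<close>

lemma killing_form_g2mat:
  "killing_form (g2mat x) (g2mat y) = 4 * trace (g2mat x ** g2mat y)"
  unfolding killing_form_def sum_1_14 bas_numeral commutator_g2mat coord_g2mat_numeral
    g2bracket_nth trace_g2mat
  by (simp add: algebra_simps)

section \<open>The Lie algebra of \<open>G\<^sub>2\<close>\<close>

lemma bounded_bilinear_matrix_matrix_mult:
  "bounded_bilinear ((**) :: real^'n^'m \<Rightarrow> real^'p^'n \<Rightarrow> real^'p^'m)"
  unfolding bilinear_conv_bounded_bilinear[symmetric] bilinear_def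
  by (auto intro!: linearI simp: matrix_matrix_mult_def vec_eq_iff algebra_simps sum.distrib
      sum_distrib_left)

lemma bounded_linear_matrix_vector_mult_left:
  "bounded_linear (\<lambda>A :: real^'n^'m. A *v x)"
  unfolding linear_conv_bounded_linear[symmetric]
  by (auto intro!: linearI simp: matrix_vector_mult_add_rdistrib scaleR_matrix_vector_assoc)

lemma e3_eq:
  "e3 i j k u v w =
     u $ i * (v $ j * w $ k - v $ k * w $ j) - u $ j * (v $ i * w $ k - v $ k * w $ i)
     + u $ k * (v $ i * w $ j - v $ j * w $ i)"
  by (simp add: e3_def det_3 algebra_simps)

lemma has_real_derivative_e3:
  assumes "(f has_vector_derivative f') (at t)" "(g has_vector_derivative g') (at t)"
    "(h has_vector_derivative h') (at t)"
  shows "((\<lambda>s. e3 i j k (f s) (g s) (h s)) has_real_derivative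
    e3 i j k f' (g t) (h t) + e3 i j k (f t) g' (h t) + e3 i j k (f t) (g t) h') (at t)"
proof -
  have [derivative_intros]:
    "((\<lambda>s. f s $ l) has_real_derivative f' $ l) (at t)"
    "((\<lambda>s. g s $ l) has_real_derivative g' $ l) (at t)"
    "((\<lambda>s. h s $ l) has_real_derivative h' $ l) (at t)" for l
    unfolding has_real_derivative_iff_has_vector_derivative
    by (intro bounded_linear.has_vector_derivative[OF bounded_linear_vec_nth] assms)+
  show ?thesis
    unfolding e3_eq by (auto intro!: derivative_eq_intros simp: algebra_simps)
qed

lemma has_real_derivative_phi:
  assumes "(f has_vector_derivative f') (at t)" "(g has_vector_derivative g') (at t)"
    "(h has_vector_derivative h') (at t)"
  shows "((\<lambda>s. phi (f s) (g s) (h s)) has_real_derivative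
    phi f' (g t) (h t) + phi (f t) g' (h t) + phi (f t) (g t) h') (at t)"
  unfolding phi_def
  by (rule derivative_eq_intros has_real_derivative_e3[OF assms] refl)+ simp

text \<open>At the 35 triples of basis vectors with i < j < k the condition becomes a linear system
  for the 49 entries of \<open>V\<close>, whose solution space has dimension 14 = 49 - 35.\<close>

lemma phi_derivation_in_range:
  fixes V :: "real^7^7"
  assumes "\<And>u v w. phi (V *v u) v w + phi u (V *v v) w + phi u v (V *v w) = 0"
  shows "V \<in> range g2mat"
proof -
  let ?D = "\<lambda>i j k. phi (column i V) (axis j 1) (axis k 1) + phi (axis i 1) (column j V) (axis k 1)
    + phi (axis i 1) (axis j 1) (column k V)"
  have D: "?D i j k = 0" for i j k
    using assms[of "axis i 1" "axis j 1" "axis k 1"] by (simp add: matrix_vector_mult_basis)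
  note D = D[of 1 2 3] D[of 1 2 4] D[of 1 2 5] D[of 1 2 6] D[of 1 2 7] D[of 1 3 4] D[of 1 3 5]
    D[of 1 3 6] D[of 1 3 7] D[of 1 4 5] D[of 1 4 6] D[of 1 4 7] D[of 1 5 6] D[of 1 5 7]
    D[of 1 6 7] D[of 2 3 4] D[of 2 3 5] D[of 2 3 6] D[of 2 3 7] D[of 2 4 5] D[of 2 4 6]
    D[of 2 4 7] D[of 2 5 6] D[of 2 5 7] D[of 2 6 7] D[of 3 4 5] D[of 3 4 6] D[of 3 4 7]
    D[of 3 5 6] D[of 3 5 7] D[of 3 6 7] D[of 4 5 6] D[of 4 5 7] D[of 4 6 7] D[of 5 6 7]
  note D = D[unfolded phi_def e3_eq column_def axis_def vec_lambda_beta, simplified]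
  \<comment> \<open>The entries chosen are those at which \<open>g2mat\<close> shows a single
    coordinate.\<close>
  define x where "x = (\<lambda>k. [V $ 1 $ 2, V $ 1 $ 3, V $ 1 $ 7, V $ 2 $ 3, V $ 2 $ 4, V $ 2 $ 5,
    V $ 2 $ 7, V $ 3 $ 4, V $ 3 $ 5, V $ 3 $ 6, V $ 3 $ 7, V $ 4 $ 5, V $ 5 $ 6, V $ 5 $ 7] ! (k - 1))"
  have "V = g2mat x"
    unfolding matrix_eq_7 forall_7 g2mat_nth x_def
    by (simp, intro conjI) (use D in linarith)+
  then show ?thesis by blast
qed

lemma lie_algebra_G2_subset: "lie_algebra G2 \<subseteq> range g2mat"
proof
  fix V assume "V \<in> lie_algebra G2"
  then obtain c where c: "\<And>s. c s \<in> G2" "c 0 = mat 1" "(c has_vector_derivative V) (at 0)"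
    by (auto simp: lie_algebra_def tangent_space_def)
  have "phi (V *v u) v w + phi u (V *v v) w + phi u v (V *v w) = 0" for u v w
  proof -
    have d: "((\<lambda>s. c s *v x) has_vector_derivative V *v x) (at 0)" for x
      by (rule bounded_linear.has_vector_derivative[OF bounded_linear_matrix_vector_mult_left c(3)])
    have "(\<lambda>s. phi (c s *v u) (c s *v v) (c s *v w)) = (\<lambda>s. phi u v w)"
      using c(1) by (simp add: G2_def)
    then have "((\<lambda>s. phi (c s *v u) (c s *v v) (c s *v w)) has_real_derivative 0) (at 0)"
      by simp
    from DERIV_unique[OF has_real_derivative_phi[OF d[of u] d[of v] d[of w]] this]
    show ?thesis by (simp add: c(2))
  qed
  then show "V \<in> range g2mat" by (rule phi_derivation_in_range)
qed

lemma bas_cube: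
  assumes "k \<in> {1..14}"
  shows "bas k ** bas k ** bas k = - bas k"
proof -
  have "\<forall>k\<in>{1..14}. bas k ** bas k ** bas k = - bas k"
    unfolding ball_1_14 bas_numeral matrix_eq_7 forall_7 matrix_matrix_mult_def vec_lambda_beta
      sum_7 vector_uminus_component g2mat_nth by simp
  then show ?thesis using assms by blast
qed

lemma phi_bas_derivation:
  assumes "k \<in> {1..14}"
  shows "phi (bas k *v u) v w + phi u (bas k *v v) w + phi u v (bas k *v w) = 0"
proof -
  have "\<forall>k\<in>{1..14}. phi (bas k *v u) v w + phi u (bas k *v v) w + phi u v (bas k *v w) = 0"
    unfolding ball_1_14 bas_numeral phi_def e3_eq matrix_vector_mult_def vec_lambda_beta
      sum_7 g2mat_nth by (intro conjI; simp; simp add: algebra_simps)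
  then show ?thesis using assms by blast
qed

text \<open>Since \<open>X\<^sup>3 = - X\<close> for a basis element \<open>X\<close>, its one-parameter group is
  \<open>1 + sin t X + (1 - cos t) X\<^sup>2\<close>, as in Rodrigues' formula.\<close>
lemma bas_in_lie_algebra_G2:
  assumes k: "k \<in> {1..14}"
  shows "a *\<^sub>R bas k \<in> lie_algebra G2"
proof -
  define X where "X = bas k"
  define c where "c t = mat 1 + sin t *\<^sub>R X + (1 - cos t) *\<^sub>R (X ** X)" for t
  have X3: "X ** X ** X = - X"
    unfolding X_def using bas_cube[OF k] .
  have dc: "(c has_vector_derivative X ** c t) (at t)" for t
  proof -
    have "(c has_vector_derivative cos t *\<^sub>R X + sin t *\<^sub>R (X ** X)) (at t)"
      unfolding c_def by (auto intro!: derivative_eq_intros)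
    moreover have "X ** c t = cos t *\<^sub>R X + sin t *\<^sub>R (X ** X)"
      by (simp add: c_def matrix_add_ldistrib matrix_scalar_ac matrix_mul_assoc X3
          flip: scalar_matrix_assoc) (simp add: algebra_simps)
    ultimately show ?thesis by simp
  qed
  have "c t \<in> G2" for t
  proof -
    have "phi (c t *v u) (c t *v v) (c t *v w) = phi u v w" for u v w
    proof -
      have d: "((\<lambda>s. c s *v x) has_vector_derivative X *v (c t *v x)) (at t)" for x t
        using bounded_linear.has_vector_derivative[OF bounded_linear_matrix_vector_mult_left dc]
        by (simp add: matrix_vector_mul_assoc)
      \<comment> \<open>The curve solves c' = X c and \<open>X\<close> is a derivation of
        \<open>phi\<close>, so \<open>phi\<close> is constant along it.\<close>
      have "((\<lambda>s. phi (c s *v u) (c s *v v) (c s *v w)) has_real_derivative 0) (at t)" for t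
        using has_real_derivative_phi[OF d[of u t] d[of v t] d[of w t]]
        by (simp add: X_def phi_bas_derivation[OF k])
      then have "phi (c t *v u) (c t *v v) (c t *v w) = phi (c 0 *v u) (c 0 *v v) (c 0 *v w)"
        using DERIV_isconst_all[of "\<lambda>s. phi (c s *v u) (c s *v v) (c s *v w)"] by blast
      then show ?thesis by (simp add: c_def)
    qed
    then show ?thesis by (simp add: G2_def)
  qed
  moreover have "((\<lambda>s. c (a * s)) has_vector_derivative a *\<^sub>R X) (at 0)"
  proof -
    have "((\<lambda>s. a * s) has_vector_derivative a) (at 0)"
      by (auto intro!: derivative_eq_intros)
    from vector_diff_chain_at[OF this, of c X] dc[of 0] show ?thesis
      by (simp add: o_def c_def)
  qed
  ultimately show ?thesis
    unfolding lie_algebra_def tangent_space_def X_def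
    by (auto intro!: exI[of _ "\<lambda>s. c (a * s)"] simp: c_def)
qed

section \<open>Products and inverses in \<open>G2\<close>\<close>

lemma G2_mult: "A \<in> G2 \<Longrightarrow> B \<in> G2 \<Longrightarrow> A ** B \<in> G2"
  by (simp add: G2_def flip: matrix_vector_mul_assoc)

lemma mat_1_in_G2: "mat 1 \<in> G2"
  by (simp add: G2_def)

text \<open>A set of velocities is not a subspace by definition; the sum is the velocity of the
  product curve, because both curves pass through the identity.\<close>

lemma lie_algebra_add:
  assumes mult: "\<And>A B. A \<in> G \<Longrightarrow> B \<in> G \<Longrightarrow> A ** B \<in> G"
    and "X \<in> lie_algebra G" "Y \<in> lie_algebra G"
  shows "X + Y \<in> lie_algebra G"
proof -
  from assms(2,3) obtain c d where c: "\<And>s. c s \<in> G" "c 0 = mat 1" "(c has_vector_derivative X) (at 0)"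
    and d: "\<And>s. d s \<in> G" "d 0 = mat 1" "(d has_vector_derivative Y) (at 0)"
    by (auto simp: lie_algebra_def tangent_space_def)
  have "((\<lambda>s. c s ** d s) has_vector_derivative X + Y) (at 0)"
    using bounded_bilinear.has_vector_derivative[OF bounded_bilinear_matrix_matrix_mult c(3) d(3)]
    by (simp add: c(2) d(2) add.commute)
  then show ?thesis
    unfolding lie_algebra_def tangent_space_def
    using mult[OF c(1) d(1)] by (auto intro!: exI[of _ "\<lambda>s. c s ** d s"] simp: c(2) d(2))
qed

lemma lie_algebra_G2: "lie_algebra G2 = range g2mat"
proof
  show "range g2mat \<subseteq> lie_algebra G2"
  proof
    fix X :: "real^7^7" assume "X \<in> range g2mat"
    then obtain x where X: "X = (\<Sum>k = 1..14. x k *\<^sub>R bas k)"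
      unfolding sum_bas by blast
    show "X \<in> lie_algebra G2"
      unfolding X sum_1_14
      by (intro lie_algebra_add G2_mult bas_in_lie_algebra_G2) auto
  qed
qed (rule lie_algebra_G2_subset)

text \<open>\<open>phi\<close> is nondegenerate: its seven index triples form a Fano plane, so every
  pair of indices lies in exactly one triple, and evaluating on the corresponding two basis vectors
  isolates one coordinate of \<open>u\<close> up to sign.\<close>

lemma G2_inj:
  assumes "A \<in> G2" "A *v u = 0"
  shows "u = 0"
proof -
  have z: "phi u v w = 0" for v w
  proof -
    have "phi u v w = phi (A *v u) (A *v v) (A *v w)"
      using assms(1) by (simp add: G2_def)
    then show ?thesis by (simp add: assms(2) phi_def e3_eq)
  qed
  show ?thesis
    using z[of "axis 4 1" "axis 7 1"] z[of "axis 5 1" "axis 7 1"] z[of "axis 6 1" "axis 7 1"]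
      z[of "axis 1 1" "axis 7 1"] z[of "axis 2 1" "axis 7 1"] z[of "axis 3 1" "axis 7 1"]
      z[of "axis 1 1" "axis 4 1"]
    unfolding vec_eq_iff forall_7 by (simp add: phi_def e3_eq axis_def)
qed

lemma G2_inverse:
  assumes "A \<in> G2"
  shows "A ** matrix_inv A = mat 1" "matrix_inv A ** A = mat 1" "matrix_inv A \<in> G2"
proof -
  have "inj ((*v) A)"
    using G2_inj[OF assms] by (simp add: linear_injective_0[OF matrix_vector_mul_linear])
  then have "invertible A"
    using invertible_left_inverse matrix_left_invertible_injective by blast
  then show 1: "A ** matrix_inv A = mat 1" "matrix_inv A ** A = mat 1"
    unfolding invertible_def matrix_inv_def by (metis (mono_tags, lifting) someI_ex)+
  have "phi (matrix_inv A *v u) (matrix_inv A *v v) (matrix_inv A *v w) = phi u v w" for u v w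
  proof -
    have "phi (matrix_inv A *v u) (matrix_inv A *v v) (matrix_inv A *v w)
      = phi (A *v (matrix_inv A *v u)) (A *v (matrix_inv A *v v)) (A *v (matrix_inv A *v w))"
      using assms by (simp add: G2_def)
    then show ?thesis by (simp add: matrix_vector_mul_assoc 1)
  qed
  then show "matrix_inv A \<in> G2" by (simp add: G2_def)
qed

section \<open>The adjoint action of the torus\<close>

text \<open>Handles the second-order remainder in the expansion of the inverse. An inner product is
  assumed so that the squared norm of \<open>g\<close> is differentiable; its derivative at 0
  vanishes with \<open>g 0\<close>.\<close>

lemma has_vector_derivative_quadratic_bound:
  fixes g :: "real \<Rightarrow> 'a::real_inner" and p :: "real \<Rightarrow> 'b::real_normed_vector"
  assumes g: "(g has_vector_derivative V) (at 0)" "g 0 = 0"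
    and le: "\<And>s. norm (p s) \<le> M * (norm (g s))\<^sup>2"
  shows "(p has_vector_derivative 0) (at 0)"
proof -
  have p0: "p 0 = 0" using le[of 0] g(2) by simp
  have "((\<lambda>s. g s \<bullet> g s) has_vector_derivative g 0 \<bullet> V + V \<bullet> g 0) (at 0)"
    by (rule bounded_bilinear.has_vector_derivative[OF bounded_bilinear_inner g(1) g(1)])
  then have "((\<lambda>s. g s \<bullet> g s) has_real_derivative 0) (at 0)"
    by (simp add: g(2) has_real_derivative_iff_has_vector_derivative)
  then have "((\<lambda>s. (g s \<bullet> g s) / s) \<longlongrightarrow> 0) (at 0)"
    by (simp add: has_field_derivative_iff g(2))
  then have "((\<lambda>s. M * ((g s \<bullet> g s) / s)) \<longlongrightarrow> 0) (at 0)"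
    by (rule tendsto_mult_right_zero)
  then have "((\<lambda>s. \<bar>M * ((g s \<bullet> g s) / s)\<bar>) \<longlongrightarrow> 0) (at 0)"
    by (rule tendsto_rabs_zero)
  then have "((\<lambda>s. norm (p s) / \<bar>s\<bar>) \<longlongrightarrow> 0) (at 0)"
  proof (rule Lim_null_comparison[rotated])
    have "norm (norm (p s) / \<bar>s\<bar>) \<le> \<bar>M * ((g s \<bullet> g s) / s)\<bar>" for s
    proof -
      have "norm (p s) \<le> \<bar>M * (g s \<bullet> g s)\<bar>"
        using le[of s] by (simp add: power2_norm_eq_inner)
      then have "norm (p s) / \<bar>s\<bar> \<le> \<bar>M * (g s \<bullet> g s)\<bar> / \<bar>s\<bar>"
        by (rule divide_right_mono) simp
      then show ?thesis by (simp add: abs_mult)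
    qed
    then show "\<forall>\<^sub>F s in at 0. norm (norm (p s) / \<bar>s\<bar>) \<le> \<bar>M * ((g s \<bullet> g s) / s)\<bar>"
      by (simp add: always_eventually)
  qed
  then show ?thesis
    unfolding has_vector_derivative_def has_derivative_iff_norm by (simp add: p0)
qed

lemma matrix_inv_unique:
  fixes A B :: "'a::semiring_1^'n^'n"
  assumes "A ** B = mat 1" "B ** A = mat 1"
  shows "matrix_inv A = B"
proof -
  have "A ** matrix_inv A = mat 1 \<and> matrix_inv A ** A = mat 1"
    unfolding matrix_inv_def by (rule someI[of _ B]) (simp add: assms)
  then show ?thesis
    by (metis assms(2) matrix_mul_assoc matrix_mul_lid matrix_mul_rid)
qed

text \<open>With \<open>c = 1 + g\<close>, the inverse is \<open>1 - g + c\<^sup>-\<^sup>1 g\<^sup>2\<close>, where \<open>c\<^sup>-\<^sup>1\<close> is bounded.\<close>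
lemma matrix_inv_has_vector_derivative:
  fixes c :: "real \<Rightarrow> real^'n^'n"
  assumes c: "(c has_vector_derivative V) (at 0)" "c 0 = mat 1"
    and inv: "\<And>s. matrix_inv (c s) ** c s = mat 1"
    and bdd: "\<And>s. norm (matrix_inv (c s)) \<le> M"
  shows "((\<lambda>s. matrix_inv (c s)) has_vector_derivative - V) (at 0)"
proof -
  define g where "g s = c s - mat 1" for s
  define f where "f s = matrix_inv (c s)" for s
  have g: "(g has_vector_derivative V) (at 0)" "g 0 = 0"
    unfolding g_def using c by (auto intro!: derivative_eq_intros)
  have cg: "c s = mat 1 + g s" for s by (simp add: g_def)
  have fg: "f s ** g s = mat 1 - f s" for s
    using inv[of s] by (simp add: cg f_def matrix_add_ldistrib algebra_simps)
  have f_eq: "f s = mat 1 - g s + f s ** g s ** g s" for s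
    unfolding fg using fg[of s]
    by (simp add: bounded_bilinear.diff_left[OF bounded_bilinear_matrix_matrix_mult])
  obtain K where K: "K \<ge> 0" "\<And>a b. norm ((a :: real^'n^'n) ** (b :: real^'n^'n)) \<le> norm a * norm b * K"
    using bounded_bilinear.nonneg_bounded[OF bounded_bilinear_matrix_matrix_mult] by blast
  have "norm (f s ** g s ** g s) \<le> (M * K * K) * (norm (g s))\<^sup>2" for s
  proof -
    have "norm (f s ** g s ** g s) \<le> norm (f s ** g s) * norm (g s) * K"
      by (rule K)
    also have "\<dots> \<le> (norm (f s) * norm (g s) * K) * norm (g s) * K"
      by (intro mult_right_mono K) auto
    also have "\<dots> \<le> (M * norm (g s) * K) * norm (g s) * K"
      using bdd[of s] K(1) by (intro mult_right_mono) (auto simp: f_def)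
    finally show ?thesis by (simp add: power2_eq_square mult_ac)
  qed
  from has_vector_derivative_quadratic_bound[OF g this]
  have "((\<lambda>s. mat 1 - g s + f s ** g s ** g s) has_vector_derivative - V) (at 0)"
    using g(1) by (auto intro!: derivative_eq_intros)
  then show ?thesis
    unfolding f_eq[symmetric] by (simp add: f_def)
qed

text \<open>Differentiate \<open>A ** c s = c s ** A\<close> at time 0.\<close>

lemma torus_commute_lie_algebra:
  assumes "torus S" "A \<in> S" "X \<in> lie_algebra S"
  shows "A ** X = X ** A"
proof -
  from assms(3) obtain c where c: "\<And>s. c s \<in> S" "(c has_vector_derivative X) (at 0)"
    by (auto simp: lie_algebra_def tangent_space_def)
  have "(\<lambda>s. A ** c s) = (\<lambda>s. c s ** A)"
    using assms c(1) by (auto simp: torus_def)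
  moreover have "((\<lambda>s. A ** c s) has_vector_derivative A ** X) (at 0)"
    by (rule bounded_linear.has_vector_derivative[OF bounded_bilinear.bounded_linear_right
          [OF bounded_bilinear_matrix_matrix_mult] c(2)])
  moreover have "((\<lambda>s. c s ** A) has_vector_derivative X ** A) (at 0)"
    by (rule bounded_linear.has_vector_derivative[OF bounded_bilinear.bounded_linear_left
          [OF bounded_bilinear_matrix_matrix_mult] c(2)])
  ultimately show ?thesis
    using vector_derivative_unique_at by metis
qed

section \<open>Translating tangent vectors\<close>

lemma tangent_space_left_translate:
  assumes mult: "\<And>A B. A \<in> G \<Longrightarrow> B \<in> G \<Longrightarrow> A ** B \<in> G"
    and "B \<in> G" "U \<in> tangent_space G F"
  shows "B ** U \<in> tangent_space G (B ** F)"
proof -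
  from assms(3) obtain c where c: "\<And>s. c s \<in> G" "c 0 = F" "(c has_vector_derivative U) (at 0)"
    by (auto simp: tangent_space_def)
  have "((\<lambda>s. B ** c s) has_vector_derivative B ** U) (at 0)"
    by (rule bounded_linear.has_vector_derivative[OF bounded_bilinear.bounded_linear_right
          [OF bounded_bilinear_matrix_matrix_mult] c(3)])
  then show ?thesis
    unfolding tangent_space_def using mult[OF assms(2) c(1)] c(2)
    by (auto intro!: exI[of _ "\<lambda>s. B ** c s"])
qed

lemma tangent_space_right_translate:
  assumes mult: "\<And>A B. A \<in> G \<Longrightarrow> B \<in> G \<Longrightarrow> A ** B \<in> G"
    and "B \<in> G" "U \<in> tangent_space G F"
  shows "U ** B \<in> tangent_space G (F ** B)"
proof -
  from assms(3) obtain c where c: "\<And>s. c s \<in> G" "c 0 = F" "(c has_vector_derivative U) (at 0)"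
    by (auto simp: tangent_space_def)
  have "((\<lambda>s. c s ** B) has_vector_derivative U ** B) (at 0)"
    by (rule bounded_linear.has_vector_derivative[OF bounded_bilinear.bounded_linear_left
          [OF bounded_bilinear_matrix_matrix_mult] c(3)])
  then show ?thesis
    unfolding tangent_space_def using mult[OF c(1) assms(2)] c(2)
    by (auto intro!: exI[of _ "\<lambda>s. c s ** B"])
qed

lemma G2_tangent_space_left:
  assumes "F \<in> G2" "U \<in> tangent_space G2 F"
  shows "matrix_inv F ** U \<in> range g2mat"
  using tangent_space_left_translate[OF G2_mult G2_inverse(3)[OF assms(1)] assms(2)]
  by (simp add: G2_inverse(2)[OF assms(1)] lie_algebra_def flip: lie_algebra_G2)

lemma G2_adjoint:
  assumes "A \<in> G2" "X \<in> range g2mat"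
  shows "matrix_inv A ** X ** A \<in> range g2mat"
proof -
  have "X \<in> tangent_space G2 (mat 1)"
    using assms(2) by (simp flip: lie_algebra_G2 add: lie_algebra_def)
  then have "X ** A \<in> tangent_space G2 A"
    using tangent_space_right_translate[OF G2_mult assms(1)] by fastforce
  from G2_tangent_space_left[OF assms(1) this] show ?thesis
    by (simp add: matrix_mul_assoc)
qed

text \<open>The component in the \<open>k\<close>-th root plane, which for \<open>k \<ge> 1\<close> is spanned by \<open>u\<close> and \<open>J u\<close>
  with \<open>u\<close> equal to \<open>b\<^sub>1\<^sub>3\<close>, \<open>b\<^sub>4 + b\<^sub>1\<^sub>3 / 2\<close>, \<open>b\<^sub>7\<close>, \<open>b\<^sub>8 - b\<^sub>7 / 2\<close>, \<open>b\<^sub>6\<close>,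
  \<open>b\<^sub>1\<^sub>0 - b\<^sub>6 / 2\<close>; for \<open>k = 0\<close>, the component in the Lie algebra of the torus.\<close>
definition plane_part :: "nat \<Rightarrow> (nat \<Rightarrow> real) \<Rightarrow> nat \<Rightarrow> real" where
  "plane_part k x = (\<lambda>i.
     [if i = 1 then x 1 else if i = 12 then x 12 else 0,
      if i = 13 then x 13 - x 4 / 2 else if i = 14 then x 14 - x 2 / 2 else 0,
      if i = 4 then x 4 else if i = 13 then x 4 / 2 else if i = 2 then x 2 else
      if i = 14 then x 2 / 2 else 0,
      if i = 7 then x 7 + x 8 / 2 else if i = 3 then x 3 - x 9 / 2 else 0,
      if i = 8 then x 8 else if i = 7 then - x 8 / 2 else if i = 9 then x 9 else
      if i = 3 then x 9 / 2 else 0,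
      if i = 6 then x 6 + x 10 / 2 else if i = 5 then x 5 - x 11 / 2 else 0,
      if i = 10 then x 10 else if i = 6 then - x 10 / 2 else if i = 11 then x 11 else
      if i = 5 then x 11 / 2 else 0] ! k)"

text \<open>The coefficients are chosen such that the weights on the six root planes have distinct
  absolute values.\<close>
definition regular_elt :: "real^7^7" where
  "regular_elt = bas 1 + 4 *\<^sub>R bas 12"

text \<open>The signs are relative to the orientation of each plane given by \<open>J\<close>:
  bracketing with \<open>regular_elt\<close> is \<open>plane_weight k\<close> times \<open>J\<close>
  there. Index 0 is the torus.\<close>

definition plane_weight :: "nat \<Rightarrow> real" where
  "plane_weight k = [0, -7, 1, -2, -4, 5, -3] ! k"

lemma atMost_6: "{..6} = {0, 1, 2, 3, 4, 5, 6::nat}"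
  by (rule set_eqI) (simp, arith)

lemma sum_atMost_6: "sum f {..6::nat} = f 0 + f 1 + f 2 + f 3 + f 4 + f 5 + f 6"
  unfolding atMost_6 by (simp add: ac_simps)

lemma ball_atMost_6: "(\<forall>k\<in>{..6::nat}. P k) \<longleftrightarrow> P 0 \<and> P 1 \<and> P 2 \<and> P 3 \<and> P 4 \<and> P 5 \<and> P 6"
  unfolding atMost_6 by simp

lemma sum_plane_part: "(\<Sum>k\<le>6. g2mat (plane_part k x)) = g2mat x"
  unfolding sum_atMost_6 g2mat_add g2mat_eq_iff ball_1_14 by (simp add: plane_part_def)

definition bracket_regular :: "(nat \<Rightarrow> real) \<Rightarrow> nat \<Rightarrow> real" where
  "bracket_regular x k =
     [0, x 4, - 2 * x 7 - 3 * x 8, - x 2, 5 * x 6 + x 10, x 11 - 5 * x 5, 2 * x 3 - 3 * x 9,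
      4 * x 9, - 4 * x 8, 3 * x 11, - 3 * x 10, 0, 7 * x 14 - 4 * x 2, 4 * x 4 - 7 * x 13] ! (k - 1)"

lemma bracket_regular_nth:
  "bracket_regular x 1 = 0" "bracket_regular x 2 = x 4"
  "bracket_regular x 3 = - 2 * x 7 - 3 * x 8" "bracket_regular x 4 = - x 2"
  "bracket_regular x 5 = 5 * x 6 + x 10" "bracket_regular x 6 = x 11 - 5 * x 5"
  "bracket_regular x 7 = 2 * x 3 - 3 * x 9" "bracket_regular x 8 = 4 * x 9"
  "bracket_regular x 9 = - 4 * x 8" "bracket_regular x 10 = 3 * x 11"
  "bracket_regular x 11 = - 3 * x 10" "bracket_regular x 12 = 0"
  "bracket_regular x 13 = 7 * x 14 - 4 * x 2" "bracket_regular x 14 = 4 * x 4 - 7 * x 13"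
  by (simp_all add: bracket_regular_def)

lemma commutator_regular_g2mat:
  "commutator regular_elt (g2mat x) = g2mat (bracket_regular x)"
  unfolding regular_elt_def bas_numeral g2mat_scaleR g2mat_add commutator_g2mat g2mat_eq_iff
    ball_1_14 g2bracket_nth by (simp add: bracket_regular_nth)

lemma plane_part_eigen:
  assumes "k \<le> 6"
  shows "commutator regular_elt (commutator regular_elt (g2mat (plane_part k x)))
    = - (plane_weight k)\<^sup>2 *\<^sub>R g2mat (plane_part k x)"
proof -
  have "\<forall>k\<in>{..6}. commutator regular_elt (commutator regular_elt (g2mat (plane_part k x)))
    = - (plane_weight k)\<^sup>2 *\<^sub>R g2mat (plane_part k x)"
    unfolding ball_atMost_6 commutator_regular_g2mat g2mat_scaleR g2mat_eq_iff ball_1_14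
      bracket_regular_nth
    by (simp add: plane_part_def plane_weight_def)
  then show ?thesis using assms by blast
qed

text \<open>The squared weights are distinct and nonzero, so the eigenvalue equation places
  \<open>Y\<close> in the \<open>k\<close>-th root plane. Membership is phrased through the equation
  because that is what survives conjugation by an element of the torus.\<close>

lemma J_on_plane:
  assumes "k \<in> {1..6}" "Y \<in> range g2mat"
    and "commutator regular_elt (commutator regular_elt Y) = - (plane_weight k)\<^sup>2 *\<^sub>R Y"
  shows "commutator regular_elt Y = plane_weight k *\<^sub>R samelson_J Y"
proof -
  obtain y where Y: "Y = g2mat y" using assms(2) by blast
  have k: "k \<in> {1, 2, 3, 4, 5, 6}" using assms(1) by (simp, arith)
  have "\<forall>i\<in>{1..14}. bracket_regular (bracket_regular y) i = - (plane_weight k)\<^sup>2 * y i"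
    using assms(3) unfolding Y commutator_regular_g2mat g2mat_scaleR g2mat_eq_iff .
  then have "\<forall>i\<in>{1..14}. bracket_regular y i = plane_weight k * J_coords (1 / sqrt 3) y i"
    unfolding ball_1_14 bracket_regular_nth J_coords_nth
    using k by (elim insertE emptyE) (auto simp: plane_weight_def)
  then show ?thesis
    unfolding Y commutator_regular_g2mat samelson_J_g2mat g2mat_scaleR g2mat_eq_iff .
qed

lemma samelson_J_sum:
  assumes "\<And>k. k \<in> I \<Longrightarrow> X k \<in> range g2mat"
  shows "samelson_J (sum X I) = (\<Sum>k\<in>I. samelson_J (X k)) \<and> sum X I \<in> range g2mat"
  using assms
proof (induction I rule: infinite_finite_induct)
  case (insert k I)
  have add: "samelson_J (Y + Z) = samelson_J Y + samelson_J Z \<and> Y + Z \<in> range g2mat"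
    if "Y \<in> range g2mat" "Z \<in> range g2mat" for Y Z
    using that by (auto simp: g2mat_add samelson_J_g2mat g2mat_eq_iff ball_1_14 J_coords_nth
        add_divide_distrib diff_divide_distrib algebra_simps)
  show ?case using insert add by (simp add: insert)
qed (auto simp: samelson_J_g2mat g2mat_eq_iff ball_1_14 J_coords_nth simp flip: g2mat_0)

section \<open>Conjugation of products and commutators\<close>

lemma matrix_add_rdistrib: "((A + B) ** C) = (A ** C) + (B ** C)"
  by (vector matrix_matrix_mult_def sum.distrib[symmetric] field_simps)

lemma matrix_diff_ldistrib: "(A :: 'a::ring_1^'n^'m) ** (B - C) = (A ** B) - (A ** C)"
  by (vector matrix_matrix_mult_def sum_subtractf[symmetric] field_simps)

lemma matrix_diff_rdistrib: "((A :: 'a::ring_1^'n^'m) - B) ** C = (A ** C) - (B ** C)"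
  by (vector matrix_matrix_mult_def sum_subtractf[symmetric] field_simps)

lemma commutator_adjoint:
  assumes "A ** B = mat 1" "B ** A = mat 1" "A ** H = H ** A"
  shows "commutator H (B ** X ** A) = B ** commutator H X ** A"
proof -
  have "B ** H = B ** (H ** A) ** B"
    using assms(1) by (metis matrix_mul_assoc matrix_mul_rid)
  also have "\<dots> = H ** B"
    using assms(2) by (metis assms(3) matrix_mul_assoc matrix_mul_lid)
  finally have BH: "B ** H = H ** B" .
  have "H ** (B ** X ** A) = B ** (H ** X) ** A"
    by (metis BH matrix_mul_assoc)
  moreover have "(B ** X ** A) ** H = B ** (X ** H) ** A"
    by (metis assms(3) matrix_mul_assoc)
  ultimately show ?thesis
    by (simp add: commutator_def matrix_diff_ldistrib matrix_diff_rdistrib)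
qed

lemma adjoint_fixes:
  assumes "B ** A = mat 1" "A ** H = H ** A"
  shows "B ** H ** A = (H :: 'a::semiring_1^'n^'n)"
proof -
  have "B ** H ** A = B ** (A ** H)"
    by (simp add: assms(2) matrix_mul_assoc)
  then show ?thesis by (simp add: matrix_mul_assoc assms(1))
qed

lemma adjoint_mult:
  assumes "A ** B = mat 1"
  shows "(B ** X ** A) ** (B ** Y ** A) = B ** (X ** Y) ** (A :: 'a::semiring_1^'n^'n)"
proof -
  have "(B ** X ** A) ** (B ** Y ** A) = B ** X ** (A ** B) ** Y ** A"
    by (simp only: matrix_mul_assoc)
  then show ?thesis by (simp add: assms matrix_mul_assoc)
qed

lemma samelson_J_adjoint:
  assumes A: "A \<in> G2" and comm: "A ** bas 1 = bas 1 ** A" "A ** bas 12 = bas 12 ** A"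
    and X: "X \<in> range g2mat"
  shows "samelson_J (matrix_inv A ** X ** A) = matrix_inv A ** samelson_J X ** A"
proof -
  let ?Ad = "\<lambda>X. matrix_inv A ** X ** A"
  note inv = G2_inverse(1,2)[OF A]
  have lin: "linear ?Ad"
    by (auto intro!: linearI simp: matrix_add_ldistrib matrix_add_rdistrib matrix_scalar_ac
        simp flip: scalar_matrix_assoc)
  have reg: "A ** regular_elt = regular_elt ** A"
    by (simp add: regular_elt_def matrix_add_ldistrib matrix_add_rdistrib matrix_scalar_ac comm
        flip: scalar_matrix_assoc)
  obtain x where x: "X = g2mat x" using X by blast
  define P where "P k = g2mat (plane_part k x)" for k
  have sum: "X = (\<Sum>k\<le>6. P k)"
    unfolding P_def sum_plane_part x ..
  have P: "P k \<in> range g2mat" for k by (simp add: P_def)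
  have AdP: "?Ad (P k) \<in> range g2mat" for k
    using G2_adjoint[OF A P] .
  have step: "samelson_J (?Ad (P k)) = ?Ad (samelson_J (P k))" if "k \<le> 6" for k
  proof (cases "k = 0")
    case True
    \<comment> \<open>Conjugation fixes the Lie algebra of the torus pointwise, and \<open>J\<close>
      maps this plane to itself.\<close>
    have toral: "?Ad (g2mat (\<lambda>i. if i = 1 then a else if i = 12 then b else 0))
        = g2mat (\<lambda>i. if i = 1 then a else if i = 12 then b else 0)" for a b
    proof -
      have eq: "g2mat (\<lambda>i. if i = 1 then a else if i = 12 then b else 0) = a *\<^sub>R bas 1 + b *\<^sub>R bas 12"
        by (simp add: bas_numeral g2mat_scaleR g2mat_add g2mat_eq_iff ball_1_14)
      have "?Ad (bas 1) = bas 1" "?Ad (bas 12) = bas 12"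
        by (rule adjoint_fixes[OF inv(2)], fact comm)+
      then show ?thesis
        unfolding eq by (simp add: linear_add[OF lin] linear_scale[OF lin])
    qed
    have "P 0 = g2mat (\<lambda>i. if i = 1 then x 1 else if i = 12 then x 12 else 0)"
      by (simp add: P_def plane_part_def)
    moreover have "samelson_J (P 0) = g2mat (\<lambda>i. if i = 1 then (1 / sqrt 3) * (2 * x 12 - x 1)
        else if i = 12 then (1 / sqrt 3) * (x 12 - 2 * x 1) else 0)"
      unfolding P_def samelson_J_g2mat g2mat_eq_iff ball_1_14 J_coords_nth
      by (simp add: plane_part_def)
    ultimately show ?thesis
      using True by (simp only: toral)
  next
    case False
    then have k: "k \<in> {1..6}" using that by simp
    let ?m = "plane_weight k"
    have "k \<in> {1, 2, 3, 4, 5, 6}" using k by (simp, arith)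
    then have m: "?m \<noteq> 0" by (auto simp: plane_weight_def)
    have ad: "commutator regular_elt (?Ad Z) = ?Ad (commutator regular_elt Z)" for Z
      by (rule commutator_adjoint[OF inv reg])
    have eig: "commutator regular_elt (commutator regular_elt (P k)) = - ?m\<^sup>2 *\<^sub>R P k"
      unfolding P_def by (rule plane_part_eigen[OF that])
    \<comment> \<open>Conjugation commutes with bracketing by \<open>regular_elt\<close>, so
      \<open>?Ad (P k)\<close> satisfies the same eigenvalue equation, and on both sides
      \<open>J\<close> is that bracket divided by \<open>?m\<close>.\<close>
    have "?m *\<^sub>R samelson_J (?Ad (P k)) = commutator regular_elt (?Ad (P k))"
      by (rule J_on_plane[OF k AdP, symmetric]) (simp only: ad eig linear_scale[OF lin])
    also have "\<dots> = ?Ad (?m *\<^sub>R samelson_J (P k))"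
      unfolding ad J_on_plane[OF k P eig] ..
    also have "\<dots> = ?m *\<^sub>R ?Ad (samelson_J (P k))"
      by (rule linear_scale[OF lin])
    finally show ?thesis using m by simp
  qed
  have "samelson_J (?Ad X) = samelson_J (\<Sum>k\<le>6. ?Ad (P k))"
    unfolding sum linear_sum[OF lin] ..
  also have "\<dots> = (\<Sum>k\<le>6. samelson_J (?Ad (P k)))"
    using samelson_J_sum[of "{..6}" "\<lambda>k. ?Ad (P k)"] AdP by blast
  also have "\<dots> = (\<Sum>k\<le>6. ?Ad (samelson_J (P k)))"
    by (rule sum.cong) (simp_all add: step)
  also have "\<dots> = ?Ad (samelson_J X)"
    using samelson_J_sum[of "{..6}" P] P by (simp add: sum linear_sum[OF lin])
  finally show ?thesis .
qed

text \<open>The 2-form \<open>X, Y \<mapsto> tr (K [X, Y])\<close> for this \<open>K\<close> is the difference between the fundamental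
  form of the metric and a multiple of that of the Killing form; the coefficients come from
  comparing the two metrics on the root planes.\<close>
definition toral_elt :: "real \<Rightarrow> real \<Rightarrow> real \<Rightarrow> real^7^7" where
  "toral_elt a1 a2 a3 = ((a3 - 3 * a2) / 48) *\<^sub>R bas 1 + ((3 * a2 + a3 - 2 * a1) / 48) *\<^sub>R bas 12"

lemma trace_toral_elt:
  "trace (toral_elt a1 a2 a3 ** g2mat z)
    = (9 * a2 - 2 * a1 - a3) / 24 * z 1 + (4 * a1 - 9 * a2 - a3) / 24 * z 12"
  unfolding toral_elt_def bas_numeral g2mat_scaleR g2mat_add trace_g2mat by (simp add: field_simps)

text \<open>On toral \<open>X\<close> and \<open>Y\<close> the last summand vanishes, which fixes
  the coefficient of the trace. Every ingredient of the right side is compatible with conjugation by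
  the torus, unlike the defining table of components.\<close>

lemma gmetric_eq_trace:
  assumes "X \<in> range g2mat" "Y \<in> range g2mat"
  shows "gmetric a1 a2 a3 X Y = - (2 * a1 - 3 * a2 + a3) / 48 * trace (X ** Y)
    + trace (toral_elt a1 a2 a3 ** commutator X (samelson_J Y))"
proof -
  obtain x y where xy: "X = g2mat x" "Y = g2mat y" using assms by blast
  show ?thesis
    unfolding xy gmetric_g2mat samelson_J_g2mat commutator_g2mat trace_toral_elt
      trace_g2mat g2bracket_nth(1,12) J_coords_nth(2-11,13-14) plane_form_def gmetric_weights_nth
    by (simp add: algebra_simps add_divide_distrib diff_divide_distrib)
qed

lemma trace_conj:
  assumes "A ** B = mat 1"
  shows "trace (B ** X ** A) = trace (X :: 'a::comm_semiring_1^'n^'n)"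
proof -
  have "trace (B ** X ** A) = trace (A ** (B ** X))"
    by (rule trace_mul_sym)
  then show ?thesis by (simp add: matrix_mul_assoc assms)
qed

lemma gmetric_adjoint:
  assumes A: "A \<in> G2" and comm: "A ** bas 1 = bas 1 ** A" "A ** bas 12 = bas 12 ** A"
    and X: "X \<in> range g2mat" and Y: "Y \<in> range g2mat"
  shows "gmetric a1 a2 a3 (matrix_inv A ** X ** A) (matrix_inv A ** Y ** A) = gmetric a1 a2 a3 X Y"
proof -
  let ?B = "matrix_inv A" and ?K = "toral_elt a1 a2 a3"
  let ?Ad = "\<lambda>X. ?B ** X ** A"
  note inv = G2_inverse(1,2)[OF A]
  have mult: "?Ad U ** ?Ad V = ?Ad (U ** V)" for U V :: "real^7^7"
    using inv(1) by (rule adjoint_mult)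
  have K: "A ** ?K = ?K ** A"
    by (simp add: toral_elt_def matrix_add_ldistrib matrix_add_rdistrib matrix_scalar_ac comm
        flip: scalar_matrix_assoc)
  have "?Ad ?K = ?K"
    by (rule adjoint_fixes[OF inv(2) K])
  moreover have "commutator (?Ad X) (?Ad Z) = ?Ad (commutator X Z)" for Z
    by (simp add: commutator_def mult matrix_diff_ldistrib matrix_diff_rdistrib)
  ultimately have "?K ** commutator (?Ad X) (?Ad Z) = ?Ad (?K ** commutator X Z)" for Z
    using mult[of ?K "commutator X Z"] by simp
  then have "trace (?K ** commutator (?Ad X) (?Ad Z)) = trace (?K ** commutator X Z)" for Z
    by (simp add: trace_conj[OF inv(1)])
  then show ?thesis
    by (simp add: gmetric_eq_trace X Y G2_adjoint[OF A] samelson_J_adjoint[OF A comm Y] mult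
        trace_conj[OF inv(1)])
qed

section \<open>Torus-invariant Hermitian metrics\<close>

lemma bilinear_form_onD:
  assumes "bilinear_form_on L h"
  shows "X \<in> L \<Longrightarrow> Y \<in> L \<Longrightarrow> Z \<in> L \<Longrightarrow> h (X + Y) Z = h X Z + h Y Z"
    "X \<in> L \<Longrightarrow> Y \<in> L \<Longrightarrow> Z \<in> L \<Longrightarrow> h Z (X + Y) = h Z X + h Z Y"
    "X \<in> L \<Longrightarrow> Y \<in> L \<Longrightarrow> h (c *\<^sub>R X) Y = c * h X Y"
    "X \<in> L \<Longrightarrow> Y \<in> L \<Longrightarrow> h X (c *\<^sub>R Y) = c * h X Y"
  using assms unfolding bilinear_form_on_def by blast+

lemma bilinear_form_on_minus:
  assumes "bilinear_form_on L h" "X \<in> L" "Y \<in> L"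
  shows "h (- X) Y = - h X Y" "h X (- Y) = - h X Y"
  using bilinear_form_onD(3,4)[OF assms, of "-1"] by simp_all

lemma bilinear_form_on_sum:
  assumes h: "bilinear_form_on L h" and L: "subspace L"
    and "\<And>i. i \<in> I \<Longrightarrow> X i \<in> L" "Y \<in> L"
  shows "h (\<Sum>i\<in>I. X i) Y = (\<Sum>i\<in>I. h (X i) Y)" "h Y (\<Sum>i\<in>I. X i) = (\<Sum>i\<in>I. h Y (X i))"
proof -
  have zero: "h 0 Y = 0" "h Y 0 = 0"
    using bilinear_form_onD(3,4)[OF h \<open>Y \<in> L\<close> \<open>Y \<in> L\<close>, of 0] by simp_all
  have "h (\<Sum>i\<in>I. X i) Y = (\<Sum>i\<in>I. h (X i) Y) \<and> h Y (\<Sum>i\<in>I. X i) = (\<Sum>i\<in>I. h Y (X i))"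
    using assms(3)
  proof (induction I rule: infinite_finite_induct)
    case (insert i I)
    have "X i \<in> L" "sum X I \<in> L"
      using insert.prems by (auto intro: subspace_sum[OF L])
    then show ?case
      using insert \<open>Y \<in> L\<close> by (simp add: bilinear_form_onD(1,2)[OF h])
  qed (simp_all add: zero)
  then show "h (\<Sum>i\<in>I. X i) Y = (\<Sum>i\<in>I. h (X i) Y)" "h Y (\<Sum>i\<in>I. X i) = (\<Sum>i\<in>I. h Y (X i))"
    by blast+
qed

lemma subspace_range_g2mat: "subspace (range (g2mat :: (nat \<Rightarrow> real) \<Rightarrow> _))"
  using subspace_span[of "bas ` {1..14}"] by (simp only: span_bas)

lemma bas_in_range: "i \<in> {1..14} \<Longrightarrow> bas i \<in> range g2mat"
  by (simp add: bas_eq_g2mat)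

lemma bilinear_form_on_g2mat:
  assumes h: "bilinear_form_on (range g2mat) h"
  shows "h (g2mat x) (g2mat y) = (\<Sum>i = 1..14. \<Sum>j = 1..14. x i * y j * h (bas i) (bas j))"
proof -
  note sub = subspace_range_g2mat
  have mem: "x i *\<^sub>R bas i \<in> range g2mat" if "i \<in> {1..14}" for x :: "nat \<Rightarrow> real" and i
    using bas_in_range[OF that] subspace_scale[OF sub] by blast
  have "h (g2mat x) (g2mat y) = (\<Sum>i = 1..14. h (x i *\<^sub>R bas i) (g2mat y))"
    unfolding sum_bas[of x, symmetric] by (rule bilinear_form_on_sum(1)[OF h sub]) (auto intro: mem)
  also have "\<dots> = (\<Sum>i = 1..14. \<Sum>j = 1..14. h (x i *\<^sub>R bas i) (y j *\<^sub>R bas j))"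
    unfolding sum_bas[of y, symmetric]
    by (rule sum.cong[OF refl], rule bilinear_form_on_sum(2)[OF h sub]) (auto intro: mem)
  also have "\<dots> = (\<Sum>i = 1..14. \<Sum>j = 1..14. x i * y j * h (bas i) (bas j))"
    using mem bas_in_range
    by (intro sum.cong[OF refl]) (simp add: bilinear_form_onD(3,4)[OF h] mult_ac)
  finally show ?thesis .
qed

text \<open>Makes the coordinates of a differentiable curve differentiable, since each is a matrix
  entry.\<close>

lemma exists_g2mat_entry:
  assumes "i \<in> {1..14}"
  shows "\<exists>r s. \<forall>x :: nat \<Rightarrow> real. g2mat x $ r $ s = x i"
proof -
  have "\<forall>i\<in>{1..14}. \<exists>r s. \<forall>x :: nat \<Rightarrow> real. g2mat x $ r $ s = x i"
    unfolding ball_1_14 by (intro conjI; (rule exI)+, rule allI, rule g2mat_nth)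
  then show ?thesis using assms by blast
qed

text \<open>Outside the Lie algebra \<open>h\<close> is arbitrary, so the product rule is applied to
  the finite sum of products of coordinates.\<close>

lemma has_real_derivative_bilinear_form_on:
  assumes h: "bilinear_form_on (range g2mat) h"
    and u: "\<And>s. u s \<in> range g2mat" "(u has_vector_derivative u') (at t)" "u' \<in> range g2mat"
    and v: "\<And>s. v s \<in> range g2mat" "(v has_vector_derivative v') (at t)" "v' \<in> range g2mat"
  shows "((\<lambda>s. h (u s) (v s)) has_real_derivative h u' (v t) + h (u t) v') (at t)"
proof -
  have coord: "\<exists>x. (\<forall>s. w s = g2mat (x s)) \<and>
      (\<exists>x'. w' = g2mat x' \<and> (\<forall>i\<in>{1..14}. ((\<lambda>s. x s i) has_real_derivative x' i) (at t)))"
    if w: "\<And>s. w s \<in> range g2mat" "(w has_vector_derivative w') (at t)" "w' \<in> range g2mat"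
    for w :: "real \<Rightarrow> real^7^7" and w'
  proof -
    define x where "x s = (\<lambda>i. coord i (w s))" for s
    have x: "w s = g2mat (x s)" for s
    proof -
      obtain y where "w s = g2mat y" using w(1)[of s] by blast
      then show ?thesis by (simp add: x_def g2mat_eq_iff coord_g2mat)
    qed
    obtain x' where x': "w' = g2mat x'" using w(3) by blast
    have "((\<lambda>s. x s i) has_real_derivative x' i) (at t)" if i: "i \<in> {1..14}" for i
    proof -
      obtain r c where e: "\<And>x :: nat \<Rightarrow> real. g2mat x $ r $ c = x i"
        using exists_g2mat_entry[OF i] by blast
      have "((\<lambda>s. w s $ r $ c) has_vector_derivative w' $ r $ c) (at t)"
        by (intro bounded_linear.has_vector_derivative[OF bounded_linear_vec_nth] w(2))
      then show ?thesis
        by (simp add: x x' e has_real_derivative_iff_has_vector_derivative)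
    qed
    then show ?thesis using x x' by (intro exI conjI allI ballI) auto
  qed
  obtain x x' where x: "\<And>s. u s = g2mat (x s)" "u' = g2mat x'"
      "\<And>i. i \<in> {1..14} \<Longrightarrow> ((\<lambda>s. x s i) has_real_derivative x' i) (at t)"
    using coord[of u u', OF u] by auto
  obtain y y' where y: "\<And>s. v s = g2mat (y s)" "v' = g2mat y'"
      "\<And>i. i \<in> {1..14} \<Longrightarrow> ((\<lambda>s. y s i) has_real_derivative y' i) (at t)"
    using coord[of v v', OF v] by auto
  have "((\<lambda>s. \<Sum>i = 1..14. \<Sum>j = 1..14. x s i * y s j * h (bas i) (bas j)) has_real_derivative
      (\<Sum>i = 1..14. \<Sum>j = 1..14. (x' i * y t j + x t i * y' j) * h (bas i) (bas j))) (at t)"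
    by (intro DERIV_sum DERIV_cmult_right, rule DERIV_cong[OF DERIV_mult[OF x(3) y(3)]]) auto
  then show ?thesis
    unfolding x(1,2) y(1,2) bilinear_form_on_g2mat[OF h]
    by (simp only: sum.distrib distrib_right)
qed

lemma matrix_inv_mat_1: "matrix_inv (mat 1) = (mat 1 :: 'a::semiring_1^'n^'n)"
  by (rule matrix_inv_unique) simp_all

text \<open>Supplies the bound \<open>M\<close> required for differentiating the inverse along a
  curve: inverses stay in the compact set \<open>S\<close>.\<close>

lemma torus_matrix_inv_bounded:
  assumes "torus S"
  shows "\<exists>M. \<forall>A\<in>S. norm (matrix_inv A) \<le> M"
proof -
  have grp: "matrix_group S" "compact S" using assms unfolding torus_def by simp_all
  then have "bounded S" by (intro compact_imp_bounded)
  then obtain M where M: "\<And>A. A \<in> S \<Longrightarrow> norm A \<le> M" by (auto simp: bounded_iff)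
  have "matrix_inv A \<in> S" if "A \<in> S" for A
  proof -
    have "\<forall>A\<in>S. \<exists>B\<in>S. A ** B = mat 1 \<and> B ** A = mat 1"
      using grp(1) unfolding matrix_group_def by (elim conjE)
    from bspec[OF this that] obtain B where B: "B \<in> S" "A ** B = mat 1" "B ** A = mat 1"
      by (elim bexE conjE)
    show ?thesis unfolding matrix_inv_unique[OF B(2,3)] by (rule B)
  qed
  then show ?thesis using M by (intro exI[of _ M] ballI) simp
qed

text \<open>Invariance is evaluated at the identity: translating back from \<open>A\<close> by left
  multiplication turns right translation into conjugation.\<close>

lemma right_invariant_imp_adjoint_invariant:
  assumes inv: "right_invariant_under G2 S (left_invariant_metric h)"
    and "A \<in> S" "X \<in> range g2mat" "Y \<in> range g2mat"
  shows "h (matrix_inv A ** X ** A) (matrix_inv A ** Y ** A) = h X Y"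
proof -
  have "X \<in> tangent_space G2 (mat 1)" "Y \<in> tangent_space G2 (mat 1)"
    using assms(3,4) by (simp_all flip: lie_algebra_G2 add: lie_algebra_def)
  then have "left_invariant_metric h (mat 1 ** A) (X ** A) (Y ** A)
      = left_invariant_metric h (mat 1) X Y"
    using inv[unfolded right_invariant_under_def, rule_format, OF \<open>A \<in> S\<close> mat_1_in_G2] by simp
  then show ?thesis
    by (simp add: left_invariant_metric_def matrix_inv_mat_1 matrix_mul_assoc)
qed

lemma right_invariant_imp_ad_skew:
  assumes S: "torus S" "S \<subseteq> G2" and H: "H \<in> lie_algebra S"
    and h: "bilinear_form_on (range g2mat) h"
    and inv: "right_invariant_under G2 S (left_invariant_metric h)"
    and X: "X \<in> range g2mat" and Y: "Y \<in> range g2mat"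
  shows "h (commutator H X) Y = - h X (commutator H Y)"
proof -
  from H obtain c where c: "\<And>s. c s \<in> S" "c 0 = mat 1" "(c has_vector_derivative H) (at 0)"
    by (auto simp: lie_algebra_def tangent_space_def)
  have cG: "c s \<in> G2" for s using c(1) S(2) by blast
  have "H \<in> lie_algebra G2"
    unfolding lie_algebra_def tangent_space_def using c cG by blast
  then have Hr: "H \<in> range g2mat" by (simp add: lie_algebra_G2)
  obtain M where M: "\<And>A. A \<in> S \<Longrightarrow> norm (matrix_inv A) \<le> M"
    using torus_matrix_inv_bounded[OF S(1)] by blast
  have d: "((\<lambda>s. matrix_inv (c s) ** Z ** c s) has_vector_derivative commutator Z H) (at 0)"
    for Z
  proof -
    note B = bounded_bilinear_matrix_matrix_mult
    have "((\<lambda>s. matrix_inv (c s)) has_vector_derivative - H) (at 0)"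
      using matrix_inv_has_vector_derivative[OF c(3,2) G2_inverse(2)[OF cG] M[OF c(1)]] .
    then have "((\<lambda>s. matrix_inv (c s) ** Z) has_vector_derivative - H ** Z) (at 0)"
      by (rule bounded_linear.has_vector_derivative[OF bounded_bilinear.bounded_linear_left[OF B]])
    from bounded_bilinear.has_vector_derivative[OF B this c(3)]
    show ?thesis
      by (simp add: c(2) matrix_inv_mat_1 commutator_def bounded_bilinear.minus_left[OF B])
  qed
  have mem: "commutator Z H \<in> range g2mat" if "Z \<in> range g2mat" for Z
    using that Hr by (auto simp: commutator_g2mat)
  have "((\<lambda>s. h (matrix_inv (c s) ** X ** c s) (matrix_inv (c s) ** Y ** c s)) has_real_derivative
      h (commutator X H) Y + h X (commutator Y H)) (at 0)"
    using has_real_derivative_bilinear_form_on[OF h G2_adjoint[OF cG X] d mem[OF X]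
        G2_adjoint[OF cG Y] d mem[OF Y]]
    by (simp add: c(2) matrix_inv_mat_1)
  moreover have "(\<lambda>s. h (matrix_inv (c s) ** X ** c s) (matrix_inv (c s) ** Y ** c s)) = (\<lambda>s. h X Y)"
    using right_invariant_imp_adjoint_invariant[OF inv c(1) X Y] by blast
  ultimately have "h (commutator X H) Y + h X (commutator Y H) = 0"
    by (simp add: DERIV_unique[OF _ DERIV_const])
  moreover have "commutator Z H = - 1 *\<^sub>R commutator H Z" for Z
    by (simp add: commutator_def)
  moreover have "commutator H Z \<in> range g2mat" if "Z \<in> range g2mat" for Z
    using that Hr by (auto simp: commutator_g2mat)
  ultimately show ?thesis
    using X Y by (simp only: bilinear_form_onD(3,4)[OF h])
qed

text \<open>The square of a skew operator is symmetric, and eigenvectors of a symmetric operator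
  with distinct eigenvalues are orthogonal.\<close>

lemma plane_parts_orthogonal:
  assumes h: "bilinear_form_on (range g2mat) h"
    and skew: "\<And>X Y. X \<in> range g2mat \<Longrightarrow> Y \<in> range g2mat \<Longrightarrow>
      h (commutator regular_elt X) Y = - h X (commutator regular_elt Y)"
    and kl: "k \<le> 6" "l \<le> 6" "k \<noteq> l"
  shows "h (g2mat (plane_part k x)) (g2mat (plane_part l y)) = 0"
proof -
  let ?ad = "commutator regular_elt"
  let ?X = "g2mat (plane_part k x)" and ?Y = "g2mat (plane_part l y)"
  have mem: "?X \<in> range g2mat" "?Y \<in> range g2mat" "?ad ?X \<in> range g2mat" "?ad ?Y \<in> range g2mat"
    by (simp_all add: commutator_regular_g2mat)
  have "h (?ad (?ad ?X)) ?Y = h ?X (?ad (?ad ?Y))"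
    using skew[OF mem(3,2)] skew[OF mem(1,4)] by simp
  then have "(plane_weight k)\<^sup>2 * h ?X ?Y = (plane_weight l)\<^sup>2 * h ?X ?Y"
    unfolding plane_part_eigen[OF kl(1)] plane_part_eigen[OF kl(2)]
      bilinear_form_onD(3,4)[OF h mem(1,2)] by simp
  moreover have "\<forall>k\<in>{..6}. \<forall>l\<in>{..6}. k \<noteq> l \<longrightarrow> (plane_weight k)\<^sup>2 \<noteq> (plane_weight l)\<^sup>2"
    unfolding ball_atMost_6 by (simp add: plane_weight_def)
  then have "(plane_weight k)\<^sup>2 \<noteq> (plane_weight l)\<^sup>2" using kl by simp
  ultimately show ?thesis by simp
qed

text \<open>For \<open>k\<close> from 1 to 6, the vector \<open>u\<close> that spans the plane
  together with \<open>J u\<close>; for 0, the basis vector \<open>bas 1\<close>, whose length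
  determines a Hermitian form on the torus.\<close>

definition plane_vec :: "nat \<Rightarrow> nat \<Rightarrow> real" where
  "plane_vec k = (\<lambda>i.
     [if i = 1 then 1 else 0, if i = 13 then 1 else 0,
      if i = 4 then 1 else if i = 13 then 1 / 2 else 0, if i = 7 then 1 else 0,
      if i = 8 then 1 else if i = 7 then - 1 / 2 else 0, if i = 6 then 1 else 0,
      if i = 10 then 1 else if i = 6 then - 1 / 2 else 0] ! k)"

definition metric_weight :: "(real^7^7 \<Rightarrow> real^7^7 \<Rightarrow> real) \<Rightarrow> nat \<Rightarrow> real" where
  "metric_weight h k = h (g2mat (plane_vec k)) (g2mat (plane_vec k))"

text \<open>Since \<open>J\<close> is an isometry, \<open>u\<close> and \<open>J u\<close> have
  equal length, and h(u, Ju) = h(Ju, -u) forces orthogonality.\<close>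

lemma hermitian_plane:
  assumes h: "bilinear_form_on L h" and L: "subspace L"
    and sym: "\<And>X Y. X \<in> L \<Longrightarrow> Y \<in> L \<Longrightarrow> h X Y = h Y X"
    and herm: "\<And>X Y. X \<in> L \<Longrightarrow> Y \<in> L \<Longrightarrow> h (J X) (J Y) = h X Y"
    and uv: "u \<in> L" "v \<in> L" "J u = v" "J v = - u"
  shows "h (a *\<^sub>R u + b *\<^sub>R v) (c *\<^sub>R u + d *\<^sub>R v) = h u u * (a * c + b * d)"
proof -
  have "h v v = h u u" using herm[OF uv(1,1)] uv(3) by simp
  moreover have "h u v = 0"
    using herm[OF uv(1,2)] sym[OF uv(1,2)] uv by (simp add: bilinear_form_on_minus[OF h])
  moreover have "h v u = 0" using calculation sym[OF uv(1,2)] by simp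
  moreover have "x *\<^sub>R u \<in> L" "x *\<^sub>R v \<in> L" "x *\<^sub>R u + y *\<^sub>R v \<in> L" for x y
    using uv L by (simp_all add: subspace_scale subspace_add)
  ultimately show ?thesis
    using uv(1,2) by (simp add: bilinear_form_onD[OF h] algebra_simps)
qed

lemma invariant_hermitian_eq_plane_form:
  assumes h: "hermitian_metric_on (range g2mat) samelson_J h"
    and skew: "\<And>X Y. X \<in> range g2mat \<Longrightarrow> Y \<in> range g2mat \<Longrightarrow>
      h (commutator regular_elt X) Y = - h X (commutator regular_elt Y)"
  shows "h (g2mat x) (g2mat y) = plane_form (metric_weight h) x y"
proof -
  let ?L = "range (g2mat :: (nat \<Rightarrow> real) \<Rightarrow> _)"
  have bil: "bilinear_form_on ?L h"
    and sym: "\<And>X Y. X \<in> ?L \<Longrightarrow> Y \<in> ?L \<Longrightarrow> h X Y = h Y X"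
    and herm: "\<And>X Y. X \<in> ?L \<Longrightarrow> Y \<in> ?L \<Longrightarrow> h (samelson_J X) (samelson_J Y) = h X Y"
    using h unfolding hermitian_metric_on_def inner_product_on_def by blast+
  have mem: "g2mat z \<in> ?L" for z by simp
  have "h (g2mat x) (g2mat y) = (\<Sum>k\<le>6. \<Sum>l\<le>6. h (g2mat (plane_part k x)) (g2mat (plane_part l y)))"
    unfolding sum_plane_part[of x, symmetric] sum_plane_part[of y, symmetric]
    by (subst bilinear_form_on_sum(1)[OF bil subspace_range_g2mat])
      (auto simp: sum_plane_part bilinear_form_on_sum(2)[OF bil subspace_range_g2mat, of "{..6}", symmetric])
  also have "\<dots> = (\<Sum>k\<le>6. \<Sum>l\<le>6. if l = k then h (g2mat (plane_part k x)) (g2mat (plane_part k y)) else 0)"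
    by (intro sum.cong refl) (simp add: plane_parts_orthogonal[OF bil skew])
  also have "\<dots> = (\<Sum>k\<le>6. h (g2mat (plane_part k x)) (g2mat (plane_part k y)))"
    by simp
  finally have split: "h (g2mat x) (g2mat y) = \<dots>" .
  have plane: "h (a *\<^sub>R g2mat u + b *\<^sub>R g2mat v) (c *\<^sub>R g2mat u + d *\<^sub>R g2mat v)
      = h (g2mat u) (g2mat u) * (a * c + b * d)"
    if "\<forall>i\<in>{1..14}. J_coords (1 / sqrt 3) u i = v i"
      "\<forall>i\<in>{1..14}. J_coords (1 / sqrt 3) v i = - u i"
    for u v a b c d
    by (rule hermitian_plane[OF bil subspace_range_g2mat sym herm mem mem])
      (use that in \<open>simp_all add: samelson_J_g2mat g2mat_minus g2mat_eq_iff\<close>)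
  let ?a = "\<lambda>k x :: nat \<Rightarrow> real. [0, x 13 - x 4 / 2, x 4, x 7 + x 8 / 2, x 8, x 6 + x 10 / 2, x 10] ! k"
  let ?b = "\<lambda>k x :: nat \<Rightarrow> real. [0, x 14 - x 2 / 2, x 2, x 3 - x 9 / 2, x 9, x 5 - x 11 / 2, x 11] ! k"
  let ?J = "J_coords (1 / sqrt 3)"
  have root: "\<forall>k\<in>{..6}. k \<noteq> 0 \<longrightarrow> h (g2mat (plane_part k x)) (g2mat (plane_part k y))
      = metric_weight h k * (?a k x * ?a k y + ?b k x * ?b k y)"
  proof (intro ballI impI)
    fix k :: nat assume k: "k \<in> {..6}" "k \<noteq> 0"
    have "\<forall>k\<in>{..6}. k \<noteq> 0 \<longrightarrow> (\<forall>i\<in>{1..14}. ?J (?J (plane_vec k)) i = - plane_vec k i)"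
      unfolding ball_1_14 ball_atMost_6 J_coords_nth by (simp add: plane_vec_def)
    then have "\<forall>i\<in>{1..14}. ?J (?J (plane_vec k)) i = - plane_vec k i" using k by blast
    note p = plane[OF _ this]
    have "\<forall>k\<in>{..6}. k \<noteq> 0 \<longrightarrow> (\<forall>i\<in>{1..14}. plane_part k x i = ?a k x * plane_vec k i + ?b k x * ?J (plane_vec k) i)" for x
      unfolding ball_1_14 ball_atMost_6 J_coords_nth by (simp add: plane_vec_def plane_part_def)
    then have "g2mat (plane_part k x) = ?a k x *\<^sub>R g2mat (plane_vec k) + ?b k x *\<^sub>R g2mat (?J (plane_vec k))" for x
      unfolding g2mat_scaleR g2mat_add g2mat_eq_iff using k by blast
    then show "h (g2mat (plane_part k x)) (g2mat (plane_part k y))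
      = metric_weight h k * (?a k x * ?a k y + ?b k x * ?b k y)"
      by (simp add: p metric_weight_def)
  qed
  let ?t = "\<lambda>a b i :: nat. if i = 1 then a else if i = 12 then b else (0::real)"
  have toral: "h (g2mat (?t a b)) (g2mat (?t c d)) = a * c * h (bas 1) (bas 1)
      + (a * d + b * c) * h (bas 1) (bas 12) + b * d * h (bas 12) (bas 12)" for a b c d
    using sym[of "bas 1" "bas 12"]
    unfolding bilinear_form_on_g2mat[OF bil] sum_1_14 by (simp add: bas_in_range algebra_simps)
  have Jt: "samelson_J (g2mat (?t a b)) = g2mat (?t ((2 * b - a) / sqrt 3) ((b - 2 * a) / sqrt 3))" for a b
    unfolding samelson_J_g2mat g2mat_eq_iff ball_1_14 J_coords_nth by simp
  have hJ: "h (g2mat (?t ((2 * b - a) / sqrt 3) ((b - 2 * a) / sqrt 3)))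
      (g2mat (?t ((2 * d - c) / sqrt 3) ((d - 2 * c) / sqrt 3))) = h (g2mat (?t a b)) (g2mat (?t c d))" for a b c d
    using herm[OF mem mem] by (simp only: Jt[symmetric])
  \<comment> \<open>A symmetric form on the torus has three coefficients; invariance under
    \<open>J\<close> at these two pairs leaves one.\<close>
  have "h (bas 12) (bas 12) = h (bas 1) (bas 1)" "h (bas 1) (bas 12) = - h (bas 1) (bas 1) / 2"
    using hJ[of 0 1 0 1] hJ[of 0 1 1 0] unfolding toral by simp_all
  moreover have "metric_weight h 0 = h (bas 1) (bas 1)"
    by (simp add: metric_weight_def plane_vec_def bas_numeral)
  moreover have "plane_part 0 z = ?t (z 1) (z 12)" for z
    by (simp add: plane_part_def)
  ultimately have "h (g2mat (plane_part 0 x)) (g2mat (plane_part 0 y))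
      = metric_weight h 0 * (x 1 * y 1 + x 12 * y 12 - (x 1 * y 12 + x 12 * y 1) / 2)"
    by (simp add: toral algebra_simps add_divide_distrib)
  then show ?thesis
    unfolding split sum_atMost_6 using root[unfolded ball_atMost_6] by (simp add: plane_form_def)
qed

section \<open>Pluriclosed forms from an invariant trace form\<close>

lemma ext_deriv_2_form:
  "ext_deriv \<alpha> [X, Y, Z]
    = - \<alpha> [commutator X Y, Z] + \<alpha> [commutator X Z, Y] - \<alpha> [commutator Y Z, X]"
  by (simp add: ext_deriv_def lessThan_Suc nths_Cons One_nat_def)

lemma ext_deriv_3_form:
  "ext_deriv \<beta> [X, Y, Z, W] =
    - \<beta> [commutator X Y, Z, W] + \<beta> [commutator X Z, Y, W] - \<beta> [commutator X W, Y, Z]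
    - \<beta> [commutator Y Z, X, W] + \<beta> [commutator Y W, X, Z] - \<beta> [commutator Z W, X, Y]"
  by (simp add: ext_deriv_def lessThan_Suc nths_Cons One_nat_def)

lemma type_part_1_2:
  "type_part J 1 2 \<alpha> [X, Y, Z] =
    \<alpha> [proj10 J X, proj01 J Y, proj01 J Z] + \<alpha> [proj01 J X, proj10 J Y, proj01 J Z]
    + \<alpha> [proj01 J X, proj01 J Y, proj10 J Z]"
proof -
  have "{S. S \<subseteq> {..<3::nat} \<and> card S = 1} = {{0}, {1}, {2}}"
  proof -
    have eq: "{..<3::nat} = {0, 1, 2}" by auto
    show ?thesis
      unfolding eq Pow_iff[symmetric]
      by (rule set_eqI) (auto simp: Pow_insert card_insert_if)
  qed
  moreover have "[0..<3] = [0, 1, 2::nat]"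
    by (simp add: upt_conv_Cons)
  ultimately show ?thesis
    by (simp add: type_part_def)
qed

lemma type_part_2_2:
  fixes J :: "real^'n^'n \<Rightarrow> real^'n^'n"
  defines "P \<equiv> proj10 J" and "Q \<equiv> proj01 J"
  shows "type_part J 2 2 \<alpha> [X, Y, Z, W] =
    \<alpha> [P X, P Y, Q Z, Q W] + \<alpha> [P X, Q Y, P Z, Q W] + \<alpha> [P X, Q Y, Q Z, P W]
    + \<alpha> [Q X, P Y, P Z, Q W] + \<alpha> [Q X, P Y, Q Z, P W] + \<alpha> [Q X, Q Y, P Z, P W]"
proof -
  have eq: "{..<4::nat} = {0, 1, 2, 3}" by auto
  have "{S. S \<subseteq> {..<4::nat} \<and> card S = 2} = {{0, 1}, {0, 2}, {0, 3}, {1, 2}, {1, 3}, {2, 3}}"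
  proof (rule subset_antisym, rule subsetI)
    fix S assume "S \<in> {S. S \<subseteq> {..<4::nat} \<and> card S = 2}"
    then have "S \<in> Pow {0, 1, 2, 3}" "card S = 2" by (simp_all only: eq mem_Collect_eq Pow_iff)
    then show "S \<in> {{0, 1}, {0, 2}, {0, 3}, {1, 2}, {1, 3}, {2, 3}}"
      by (simp only: Pow_insert Pow_empty) (elim UnE imageE insertE emptyE; simp)
  qed simp
  moreover have "[0..<4] = [0, 1, 2, 3::nat]"
    by (simp add: upt_conv_Cons)
  ultimately show ?thesis
    by (simp add: type_part_def P_def Q_def doubleton_eq_iff algebra_simps)
qed

section \<open>Trace identities\<close>

lemma trace_minus: "trace (- (A :: 'a::comm_ring_1^'n^'n)) = - trace A"
  by (simp add: trace_def sum_negf)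

lemma matrix_minus_left: "(- A) ** B = - ((A :: 'a::ring_1^'n^'m) ** B)"
  by (simp add: matrix_matrix_mult_def vec_eq_iff sum_negf)

lemma matrix_minus_right: "A ** (- B) = - ((A :: 'a::ring_1^'n^'m) ** B)"
  by (simp add: matrix_matrix_mult_def vec_eq_iff sum_negf)

lemmas matrix_ring_simps = matrix_add_ldistrib matrix_add_rdistrib matrix_diff_ldistrib
  matrix_diff_rdistrib matrix_minus_left matrix_minus_right trace_add trace_sub trace_minus
  matrix_mul_assoc

lemma trace_rotate: "trace (A ** B ** C) = trace (C ** A ** (B :: 'a::comm_semiring_1^'n^'n))"
  using trace_mul_sym[of "A ** B" C] by (simp add: matrix_mul_assoc)

lemma trace_commutator_swap: "trace (commutator A B ** C) = trace (A ** commutator B (C :: 'a::comm_ring_1^'n^'n))"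
  using trace_rotate[of A C B] by (simp add: commutator_def matrix_ring_simps)

lemma trace_commutator_antisym:
  fixes A B C :: "'a::comm_ring_1^'n^'n"
  shows "trace (commutator B A ** C) = - trace (commutator A B ** C)"
    "trace (commutator A C ** B) = - trace (commutator A B ** C)"
  using trace_rotate[of A C B] trace_rotate[of A B C]
  by (simp_all add: commutator_def matrix_ring_simps)

lemma commutator_antisym: "commutator B A = - commutator A B"
  by (simp add: commutator_def)

text \<open>Closedness of the Cartan 3-form, divided by two: moving \<open>X\<close> out of each
  trace leaves the Jacobi identity for \<open>Y\<close>, \<open>Z\<close>, \<open>W\<close>.\<close>

lemma trace_commutator_commutator:
  fixes X Y Z W :: "'a::comm_ring_1^'n^'n"
  shows "- trace (commutator X Y ** commutator Z W) + trace (commutator X Z ** commutator Y W)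
    - trace (commutator X W ** commutator Y Z) = 0"
proof -
  have "trace (commutator X A ** B) = trace (X ** commutator A B)" for A B
    by (rule trace_commutator_swap)
  then have "- trace (commutator X Y ** commutator Z W) + trace (commutator X Z ** commutator Y W)
    - trace (commutator X W ** commutator Y Z)
    = trace (X ** (- commutator Y (commutator Z W) + commutator Z (commutator Y W) - commutator W (commutator Y Z)))"
    by (simp add: matrix_ring_simps)
  also have "- commutator Y (commutator Z W) + commutator Z (commutator Y W) - commutator W (commutator Y Z) = 0"
    by (simp add: commutator_def matrix_ring_simps)
  finally show ?thesis by (simp add: trace_def matrix_matrix_mult_def)
qed

lemma trace_0_mult: "trace (0 :: 'a::semiring_1^'n^'n) = 0"
  "trace (A ** 0) = 0" "trace (0 ** (A :: 'a::semiring_1^'n^'n)) = 0"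
  by (simp_all add: trace_def matrix_matrix_mult_def)

text \<open>The hypothesis on \<open>\<alpha>\<close> says that \<open>\<alpha>\<close> is a multiple of the fundamental form of the bi-invariant
  trace form, up to the exact 2-form \<open>tr (K [X, Y])\<close>. Only the first summand contributes to
  \<open>d\<alpha>\<close>, whose part of type \<open>(1, 2)\<close> is therefore a multiple of that of the Cartan 3-form
  \<open>tr ([X, Y] Z)\<close>.\<close>
lemma del_delbar_trace_form_eq_0:
  fixes J :: "real^'n^'n \<Rightarrow> real^'n^'n" and L :: "(complex^'n^'n) set"
  defines "P \<equiv> proj10 J" and "Q \<equiv> proj01 J"
  assumes closed: "\<And>X Y. X \<in> L \<Longrightarrow> Y \<in> L \<Longrightarrow> commutator X Y \<in> L"
    and PL: "\<And>X. X \<in> L \<Longrightarrow> P X \<in> L" and QL: "\<And>X. X \<in> L \<Longrightarrow> Q X \<in> L"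
    and sum: "\<And>X. X \<in> L \<Longrightarrow> P X + Q X = X"
    and PQ: "\<And>X. X \<in> L \<Longrightarrow> P (P X) = P X" "\<And>X. X \<in> L \<Longrightarrow> Q (P X) = 0"
      "\<And>X. X \<in> L \<Longrightarrow> P (Q X) = 0" "\<And>X. X \<in> L \<Longrightarrow> Q (Q X) = Q X"
    and minus: "\<And>X. X \<in> L \<Longrightarrow> P (- X) = - P X" "\<And>X. X \<in> L \<Longrightarrow> Q (- X) = - Q X"
    and subalgebra: "\<And>X Y. X \<in> L \<Longrightarrow> Y \<in> L \<Longrightarrow> Q (commutator (P X) (P Y)) = 0"
      "\<And>X Y. X \<in> L \<Longrightarrow> Y \<in> L \<Longrightarrow> P (commutator (Q X) (Q Y)) = 0"
    and isotropic: "\<And>X Y. X \<in> L \<Longrightarrow> Y \<in> L \<Longrightarrow> trace (P X ** P Y) = 0"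
      "\<And>X Y. X \<in> L \<Longrightarrow> Y \<in> L \<Longrightarrow> trace (Q X ** Q Y) = 0"
    and \<alpha>: "\<And>X Y. X \<in> L \<Longrightarrow> Y \<in> L \<Longrightarrow>
      \<alpha> [X, Y] = \<mu> * (trace (P X ** Y) - trace (Q X ** Y)) + trace (K ** commutator X Y)"
    and mem: "A \<in> L" "B \<in> L" "C \<in> L" "D \<in> L"
  shows "del J 1 2 (delbar J 1 1 \<alpha>) [A, B, C, D] = 0"
proof -
  define T where "T X Y Z = trace (commutator X Y ** Z)" for X Y Z :: "complex^'n^'n"
  have T_swap: "T Y X Z = - T X Y Z" "T X Z Y = - T X Y Z" for X Y Z
    unfolding T_def by (rule trace_commutator_antisym)+
  have T_rot: "T Y Z X = T X Y Z" for X Y Z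
    using T_swap[of Y X Z] T_swap[of Y Z X] by simp
  have T_0: "T 0 Y Z = 0" "T X 0 Z = 0" "T X Y 0 = 0" for X Y Z
    by (simp_all add: T_def commutator_def trace_def matrix_matrix_mult_def)
  have T_minus: "T (- X) Y Z = - T X Y Z" for X Y Z
    by (simp add: T_def commutator_def matrix_ring_simps)

  \<comment> \<open>The sign \<open>s\<close> records the type: 1 for (1,0) and -1 for (0,1).
    Isotropy of the eigenspaces turns \<open>\<alpha>\<close> into a pure trace in the second
    argument, up to the exact term.\<close>
  define typed where "typed s X \<longleftrightarrow> X \<in> L \<and> (\<forall>V\<in>L. \<alpha> [V, X] = - \<mu> * s * trace (V ** X) + trace (K ** commutator V X))"
    for s :: complex and X
  have typed_P: "typed 1 (P X)" if "X \<in> L" for X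
    unfolding typed_def
  proof (intro conjI ballI)
    fix V assume V: "V \<in> L"
    have "trace (V ** P X) = trace (P V ** P X) + trace (Q V ** P X)"
      using sum[OF V] by (metis matrix_add_rdistrib trace_add)
    then show "\<alpha> [V, P X] = - \<mu> * 1 * trace (V ** P X) + trace (K ** commutator V (P X))"
      using \<alpha>[OF V PL[OF that]] isotropic(1)[OF V that] by simp
  qed (rule PL[OF that])
  have typed_Q: "typed (- 1) (Q X)" if "X \<in> L" for X
    unfolding typed_def
  proof (intro conjI ballI)
    fix V assume V: "V \<in> L"
    have "trace (V ** Q X) = trace (P V ** Q X) + trace (Q V ** Q X)"
      using sum[OF V] by (metis matrix_add_rdistrib trace_add)
    then show "\<alpha> [V, Q X] = - \<mu> * (- 1) * trace (V ** Q X) + trace (K ** commutator V (Q X))"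
      using \<alpha>[OF V QL[OF that]] isotropic(2)[OF V that] by simp
  qed (rule QL[OF that])
  \<comment> \<open>Each of the three bracket terms contributes the sign of its remaining argument,
    and the terms with \<open>K\<close> cancel by Jacobi. On type (1,2) the signs add up to
    -1.\<close>
  have d\<alpha>: "ext_deriv \<alpha> [X, Y, Z] = \<mu> * (s + t + u) * T X Y Z"
    if X: "typed s X" and Y: "typed t Y" and Z: "typed u Z" for s t u X Y Z
  proof -
    have L: "X \<in> L" "Y \<in> L" "Z \<in> L" using X Y Z by (simp_all add: typed_def)
    have "ext_deriv \<alpha> [X, Y, Z] = \<mu> * u * T X Y Z - \<mu> * t * T X Z Y + \<mu> * s * T Y Z X
      - trace (K ** (commutator (commutator X Y) Z - commutator (commutator X Z) Y
          + commutator (commutator Y Z) X))"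
      using X Y Z closed[OF L(1,2)] closed[OF L(1,3)] closed[OF L(2,3)]
      by (simp add: ext_deriv_2_form typed_def T_def matrix_ring_simps)
    also have "commutator (commutator X Y) Z - commutator (commutator X Z) Y
          + commutator (commutator Y Z) X = 0"
      by (simp add: commutator_def matrix_ring_simps)
    finally show ?thesis
      using T_swap(2)[of X Z Y] T_rot[of Y Z X] by (simp add: trace_0_mult algebra_simps)
  qed

  define G where "G X Y Z = T (P X) (Q Y) (Q Z) + T (Q X) (P Y) (Q Z) + T (Q X) (Q Y) (P Z)" for X Y Z
  have \<beta>: "delbar J 1 1 \<alpha> [X, Y, Z] = - \<mu> * G X Y Z" if "X \<in> L" "Y \<in> L" "Z \<in> L" for X Y Z
  proof -
    have "delbar J 1 1 \<alpha> [X, Y, Z] = type_part J 1 2 (ext_deriv \<alpha>) [X, Y, Z]"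
      by (simp add: delbar_def)
    also have "\<dots> = - \<mu> * G X Y Z"
      unfolding type_part_1_2 P_def[symmetric] Q_def[symmetric]
      by (simp add: d\<alpha>[OF typed_P typed_Q typed_Q] d\<alpha>[OF typed_Q typed_P typed_Q]
          d\<alpha>[OF typed_Q typed_Q typed_P] that G_def algebra_simps)
    finally show ?thesis .
  qed
  have G_swap: "G Y X Z = - G X Y Z" "G X Z Y = - G X Y Z" for X Y Z
    unfolding G_def using T_swap(1)[of "P X" "Q Y" "Q Z"] T_swap(1)[of "Q X" "P Y" "Q Z"]
      T_swap(1)[of "Q X" "Q Y" "P Z"] T_swap(2)[of "P X" "Q Y" "Q Z"] T_swap(2)[of "Q X" "P Y" "Q Z"]
      T_swap(2)[of "Q X" "Q Y" "P Z"] by simp_all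
  have G_minus: "G (- X) Y Z = - G X Y Z" if "X \<in> L" for X Y Z
    unfolding G_def minus[OF that] T_minus by simp

  define R where "R X Y Z W = - G (commutator X Y) Z W + G (commutator X Z) Y W - G (commutator X W) Y Z
    - G (commutator Y Z) X W + G (commutator Y W) X Z - G (commutator Z W) X Y" for X Y Z W
  have d\<beta>: "ext_deriv (delbar J 1 1 \<alpha>) [X, Y, Z, W] = - \<mu> * R X Y Z W"
    if "X \<in> L" "Y \<in> L" "Z \<in> L" "W \<in> L" for X Y Z W
    unfolding ext_deriv_3_form using that by (simp add: \<beta> closed R_def algebra_simps)
  have G_comm: "G (commutator Y X) Z W = - G (commutator X Y) Z W" if "X \<in> L" "Y \<in> L" for X Y Z W
    by (subst commutator_antisym) (rule G_minus[OF closed[OF that]])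
  have R_swap: "R Y X Z W = - R X Y Z W" "R X Z Y W = - R X Y Z W" "R X Y W Z = - R X Y Z W"
    if L: "X \<in> L" "Y \<in> L" "Z \<in> L" "W \<in> L" for X Y Z W
    unfolding R_def
    using G_comm[OF L(1,2)] G_comm[OF L(2,3)] G_comm[OF L(3,4)]
      G_swap(2)[of "commutator Z W" X Y] G_swap(2)[of "commutator X W" Y Z] G_swap(2)[of "commutator X Y" Z W]
    by simp_all
  have R_0: "R (P X) (P Y) (Q Z) (Q W) = 0" if "X \<in> L" "Y \<in> L" "Z \<in> L" "W \<in> L" for X Y Z W
  proof -
    let ?X = "P X" and ?Y = "P Y" and ?Z = "Q Z" and ?W = "Q W"
    have L: "?X \<in> L" "?Y \<in> L" "?Z \<in> L" "?W \<in> L" using that PL QL by simp_all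
    \<comment> \<open>By isotropy only the mixed terms of a trace survive, so the projected traces
      occurring in \<open>R\<close> combine in pairs to full ones.\<close>
    have split: "trace (Q A ** B) + trace (A ** Q B) = trace (A ** B)" if "A \<in> L" "B \<in> L" for A B
    proof -
      have "trace (A ** B) = trace ((P A + Q A) ** (P B + Q B))"
        "trace (Q A ** B) = trace (Q A ** (P B + Q B))" "trace (A ** Q B) = trace ((P A + Q A) ** Q B)"
        using sum that by simp_all
      then show ?thesis
        using isotropic that by (simp add: matrix_ring_simps)
    qed
    have e1: "G (commutator ?X ?Y) ?Z ?W = trace (commutator ?X ?Y ** commutator ?Z ?W)"
    proof -
      have "P (commutator ?X ?Y) = commutator ?X ?Y"
        using sum[OF closed[OF L(1,2)]] subalgebra(1)[OF that(1,2)] by simp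
      then show ?thesis
        by (simp add: G_def PQ that T_0) (simp add: T_def trace_commutator_swap)
    qed
    have e2: "G V (P A) (Q B) = trace (Q V ** commutator (P A) (Q B))" if "A \<in> L" "B \<in> L" for V A B
      by (simp add: G_def PQ that T_0) (simp add: T_def trace_commutator_swap)
    have e3: "G (commutator ?Z ?W) ?X ?Y = 0"
      by (simp add: G_def PQ that T_0)
    have "R ?X ?Y ?Z ?W = - trace (commutator ?X ?Y ** commutator ?Z ?W)
        + (trace (Q (commutator ?X ?Z) ** commutator ?Y ?W) + trace (Q (commutator ?Y ?W) ** commutator ?X ?Z))
        - (trace (Q (commutator ?X ?W) ** commutator ?Y ?Z) + trace (Q (commutator ?Y ?Z) ** commutator ?X ?W))"
      unfolding R_def e1 e2[OF that(1,3)] e2[OF that(1,4)] e2[OF that(2,3)] e2[OF that(2,4)] e3 by simp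
    also have "\<dots> = - trace (commutator ?X ?Y ** commutator ?Z ?W) + trace (commutator ?X ?Z ** commutator ?Y ?W)
        - trace (commutator ?X ?W ** commutator ?Y ?Z)"
      using split[OF closed[OF L(1,3)] closed[OF L(2,4)]] split[OF closed[OF L(1,4)] closed[OF L(2,3)]]
      by (simp add: trace_mul_sym[of "Q (commutator ?Y ?W)"] trace_mul_sym[of "Q (commutator ?Y ?Z)"])
    finally show ?thesis using trace_commutator_commutator[of ?X ?Y ?Z ?W] by simp
  qed
  \<comment> \<open>The other distributions of types follow from the first one by antisymmetry of
    \<open>R\<close>.\<close>
  have "R (P A) (Q B) (P C) (Q D) = 0" "R (P A) (Q B) (Q C) (P D) = 0"
    "R (Q A) (P B) (P C) (Q D) = 0" "R (Q A) (P B) (Q C) (P D) = 0" "R (Q A) (Q B) (P C) (P D) = 0"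
  proof -
    have 1: "R (P A) (Q B) (P C) (Q D) = 0" if "A \<in> L" "B \<in> L" "C \<in> L" "D \<in> L" for A B C D
      using R_swap(2)[of "P A" "P C" "Q B" "Q D"] R_0[of A C B D] that by (simp add: PL QL)
    have 2: "R (P A) (Q B) (Q C) (P D) = 0" if "A \<in> L" "B \<in> L" "C \<in> L" "D \<in> L" for A B C D
      using R_swap(3)[of "P A" "Q B" "P D" "Q C"] 1[of A B D C] that by (simp add: PL QL)
    have 3: "R (Q A) (P B) (P C) (Q D) = 0" if "A \<in> L" "B \<in> L" "C \<in> L" "D \<in> L" for A B C D
      using R_swap(1)[of "P B" "Q A" "P C" "Q D"] 1[of B A C D] that by (simp add: PL QL)
    have 4: "R (Q A) (P B) (Q C) (P D) = 0" if "A \<in> L" "B \<in> L" "C \<in> L" "D \<in> L" for A B C D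
      using R_swap(1)[of "P B" "Q A" "Q C" "P D"] 2[of B A C D] that by (simp add: PL QL)
    have 5: "R (Q A) (Q B) (P C) (P D) = 0" if "A \<in> L" "B \<in> L" "C \<in> L" "D \<in> L" for A B C D
      using R_swap(2)[of "Q A" "P C" "Q B" "P D"] 4[of A C B D] that by (simp add: PL QL)
    show "R (P A) (Q B) (P C) (Q D) = 0" "R (P A) (Q B) (Q C) (P D) = 0"
      "R (Q A) (P B) (P C) (Q D) = 0" "R (Q A) (P B) (Q C) (P D) = 0" "R (Q A) (Q B) (P C) (P D) = 0"
      using 1 2 3 4 5 mem by simp_all
  qed
  then show ?thesis
    unfolding del_def using R_0[OF mem] mem
    by (simp add: type_part_2_2 d\<beta> PL QL flip: P_def Q_def)
qed

section \<open>Complex coordinates\<close>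

lemma map_matrix_g2mat:
  "map_matrix Re (g2mat z) = g2mat (\<lambda>k. Re (z k))"
  "map_matrix Im (g2mat z) = g2mat (\<lambda>k. Im (z k))"
  unfolding matrix_eq_7 forall_7 g2mat_nth by (simp_all add: map_matrix_def g2mat_nth)

lemma complex_matrix_eqI:
  assumes "map_matrix Re Z = map_matrix Re W" "map_matrix Im Z = map_matrix Im W"
  shows "Z = W"
  using assms by (simp add: map_matrix_def vec_eq_iff complex_eq_iff)

lemma complexification_g2: "complexification (range g2mat) = range g2mat"
proof
  show "range g2mat \<subseteq> complexification (range g2mat)"
    by (auto simp: complexification_def map_matrix_g2mat)
  show "complexification (range g2mat) \<subseteq> range g2mat"
  proof
    fix Z :: "complex^7^7" assume "Z \<in> complexification (range g2mat)"
    then obtain x y where xy: "map_matrix Re Z = g2mat x" "map_matrix Im Z = g2mat y"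
      by (auto simp: complexification_def)
    have "Z = g2mat (\<lambda>k. Complex (x k) (y k))"
      by (rule complex_matrix_eqI) (simp_all add: xy map_matrix_g2mat)
    then show "Z \<in> range g2mat" by blast
  qed
qed

abbreviation inv_sqrt3 :: complex where
  "inv_sqrt3 \<equiv> complex_of_real (1 / sqrt 3)"

lemma inv_sqrt3_sq: "inv_sqrt3 * inv_sqrt3 = 1 / 3" "inv_sqrt3 * (inv_sqrt3 * z) = z / 3"
proof -
  have "inv_sqrt3 * inv_sqrt3 = of_real ((1 / sqrt 3) * (1 / sqrt 3))" by (simp only: of_real_mult)
  also have "\<dots> = 1 / 3" by simp
  finally show "inv_sqrt3 * inv_sqrt3 = 1 / 3" .
  then show "inv_sqrt3 * (inv_sqrt3 * z) = z / 3"
    by (simp only: mult.assoc[symmetric]) simp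
qed

lemma complexify_endo_J:
  "complexify_endo samelson_J (g2mat z) = g2mat (J_coords inv_sqrt3 z)"
proof (rule complex_matrix_eqI)
  have 1: "map_matrix Re (complexify_endo J Z) = J (map_matrix Re Z)"
    "map_matrix Im (complexify_endo J Z) = J (map_matrix Im Z)" for J and Z :: "complex^7^7"
    by (simp_all add: complexify_endo_def map_matrix_def vec_eq_iff)
  show "map_matrix Re (complexify_endo samelson_J (g2mat z)) = map_matrix Re (g2mat (J_coords inv_sqrt3 z))"
    unfolding 1 map_matrix_g2mat samelson_J_g2mat g2mat_eq_iff ball_1_14 J_coords_nth by simp
  show "map_matrix Im (complexify_endo samelson_J (g2mat z)) = map_matrix Im (g2mat (J_coords inv_sqrt3 z))"
    unfolding 1 map_matrix_g2mat samelson_J_g2mat g2mat_eq_iff ball_1_14 J_coords_nth by simp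
qed

text \<open>The projection to the eigenspace of \<open>J\<close> for \<open>e\<close> when
  \<open>e * e = - 1\<close>; keeping \<open>e\<close> symbolic treats the types (1,0) and (0,1)
  together.\<close>

definition eigen_coords :: "complex \<Rightarrow> (nat \<Rightarrow> complex) \<Rightarrow> nat \<Rightarrow> complex" where
  "eigen_coords e z k = (z k - e * J_coords inv_sqrt3 z k) / 2"

lemma proj_g2mat:
  "proj10 samelson_J (g2mat z) = g2mat (eigen_coords \<i> z)"
  "proj01 samelson_J (g2mat z) = g2mat (eigen_coords (- \<i>) z)"
  unfolding matrix_eq_7 forall_7 proj10_def proj01_def complexify_endo_J vec_lambda_beta g2mat_nth eigen_coords_def
  by (auto simp: algebra_simps add_divide_distrib diff_divide_distrib)

lemma J_coords_eigen_coords: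
  assumes "e * e = - 1"
  shows "\<forall>k\<in>{1..14}. J_coords inv_sqrt3 (eigen_coords e z) k = e * eigen_coords e z k"
proof -
  have e2: "e * (e * x) = - x" for x using assms by (simp flip: mult.assoc)
  show ?thesis
    unfolding ball_1_14 eigen_coords_def J_coords_nth
    by (simp add: field_simps e2 inv_sqrt3_sq del: of_real_divide)
qed

lemma eigen_coords_eigen:
  assumes "\<forall>k\<in>{1..14}. J_coords inv_sqrt3 z k = e * z k" "e * e = - 1"
  shows "g2mat (eigen_coords e z) = g2mat z" "g2mat (eigen_coords (- e) z) = 0"
proof -
  have e2: "e * (e * x) = - x" for x using assms(2) by (simp flip: mult.assoc)
  show "g2mat (eigen_coords e z) = g2mat z" "g2mat (eigen_coords (- e) z) = 0"
    unfolding g2mat_0[symmetric] g2mat_eq_iff using assms(1) by (simp_all add: eigen_coords_def e2)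
qed

text \<open>Parametrizes the 7-dimensional eigenspace by the coordinates 2, 3, 5, 9, 11, 12 and 14,
  so that identities on it become polynomial identities in free variables.\<close>

lemma eigen_relations:
  assumes "\<forall>k\<in>{1..14}. J_coords inv_sqrt3 z k = e * z k" and e: "e * e = - 1"
  shows "z 1 = (1 - 3 * inv_sqrt3 * e) / 2 * z 12" "z 4 = e * z 2" "z 6 = e * z 5 - e * z 11"
    "z 7 = e * z 3 - e * z 9" "z 8 = e * z 9" "z 10 = e * z 11" "z 13 = e * z 14"
proof -
  have e2: "e * (e * x) = - x" for x using e by (simp flip: mult.assoc)
  note J = assms(1)[unfolded ball_1_14 J_coords_nth]
  show "z 4 = e * z 2" "z 8 = e * z 9" "z 10 = e * z 11"
    using J by simp_all
  show 6: "z 6 = e * z 5 - e * z 11"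
    using J by (metis add_diff_cancel_right')
  show "z 7 = e * z 3 - e * z 9"
    using J by (metis add_diff_cancel_right')
  have "- z 14 = e * z 13" using J by simp
  then have "e * (- z 14) = e * (e * z 13)" by simp
  then show "z 13 = e * z 14" by (simp add: e2)
  have "inv_sqrt3 * (z 12 - 2 * z 1) = e * z 12" using J by simp
  then have "inv_sqrt3 * (inv_sqrt3 * (z 12 - 2 * z 1)) = inv_sqrt3 * (e * z 12)" by (rule arg_cong)
  then have third: "(z 12 - 2 * z 1) / 3 = inv_sqrt3 * (e * z 12)" unfolding inv_sqrt3_sq .
  have "a / 3 = b \<Longrightarrow> a = 3 * b" for a b :: complex by auto
  from this[OF third] have "z 12 - 2 * z 1 = 3 * inv_sqrt3 * e * z 12" by (simp only: mult.assoc)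
  then show "z 1 = (1 - 3 * inv_sqrt3 * e) / 2 * z 12"
    by (simp only: left_diff_distrib diff_divide_distrib times_divide_eq_left) (simp add: algebra_simps del: of_real_divide)
qed

text \<open>The ratio of the two toral coordinates is a primitive sixth root of unity.\<close>

lemma eigen_ratio_sq:
  assumes "e * e = - 1"
  defines "c \<equiv> (1 - 3 * inv_sqrt3 * e) / 2"
  shows "c * c = c - 1"
proof -
  have two: "2 * c = 1 - 3 * inv_sqrt3 * e"
    by (simp add: c_def)
  have "(2 * c) * (2 * c) = 1 - 6 * inv_sqrt3 * e + 9 * (inv_sqrt3 * inv_sqrt3) * (e * e)"
    unfolding two by (simp add: algebra_simps del: of_real_divide)
  then have "4 * (c * c) = 1 - 6 * inv_sqrt3 * e + 9 * (inv_sqrt3 * inv_sqrt3) * (e * e)"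
    by simp
  also have "\<dots> = - 2 - 6 * inv_sqrt3 * e"
    unfolding assms(1) inv_sqrt3_sq by simp
  also have "\<dots> = 4 * (c - 1)"
    unfolding c_def by (simp add: algebra_simps del: of_real_divide)
  finally show ?thesis by (simp only: mult_cancel_left) simp
qed

text \<open>Integrability of \<open>samelson_J\<close>: its eigenspaces are subalgebras. Such
  brackets have no toral component, and \<open>c\<close> enters the other components
  linearly.\<close>

lemma J_coords_g2bracket_eigen:
  assumes x: "\<forall>k\<in>{1..14}. J_coords inv_sqrt3 x k = e * x k"
    and y: "\<forall>k\<in>{1..14}. J_coords inv_sqrt3 y k = e * y k" and e: "e * e = - 1"
  shows "\<forall>k\<in>{1..14}. J_coords inv_sqrt3 (g2bracket x y) k = e * g2bracket x y k"
proof -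
  have e2: "e * (e * z) = - z" for z using e by (simp flip: mult.assoc)
  define c where "c = (1 - 3 * inv_sqrt3 * e) / 2"
  note rel = eigen_relations[OF x e, folded c_def] eigen_relations[OF y e, folded c_def]
  have t: "g2bracket x y 1 = 0" "g2bracket x y 12 = 0"
    unfolding g2bracket_nth rel by (simp_all add: algebra_simps e2)
  show ?thesis
    unfolding ball_1_14 J_coords_nth t unfolding g2bracket_nth rel
    by (intro conjI; simp add: algebra_simps e2)
qed

text \<open>Isotropy of the eigenspaces. The toral part is a multiple of
  \<open>c * c - c + 1\<close>, which vanishes.\<close>

lemma trace_eigen_coords_eq_0:
  assumes x: "\<forall>k\<in>{1..14}. J_coords inv_sqrt3 x k = e * x k"
    and y: "\<forall>k\<in>{1..14}. J_coords inv_sqrt3 y k = e * y k" and e: "e * e = - 1"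
  shows "trace (g2mat x ** g2mat y) = 0"
proof -
  have e2: "e * (e * z) = - z" for z using e by (simp flip: mult.assoc)
  define c where "c = (1 - 3 * inv_sqrt3 * e) / 2"
  have "c * c = c - 1"
    unfolding c_def by (rule eigen_ratio_sq[OF e])
  then have c2: "c * (c * z) = c * z - z" for z
    by (simp add: left_diff_distrib flip: mult.assoc)
  note rel = eigen_relations[OF x e, folded c_def] eigen_relations[OF y e, folded c_def]
  show ?thesis
    unfolding trace_g2mat rel by (simp add: algebra_simps e2 c2)
qed

lemma plane_form_complexify:
  "Complex (plane_form q x1 x2 - plane_form q y1 y2) (plane_form q x1 y2 + plane_form q y1 x2)
    = plane_form (\<lambda>k. complex_of_real (q k)) (\<lambda>k. Complex (x1 k) (y1 k)) (\<lambda>k. Complex (x2 k) (y2 k))"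
  unfolding complex_eq_iff by (simp add: plane_form_def algebra_simps add_divide_distrib diff_divide_distrib)

lemma complexify_fundamental_form:
  assumes "\<And>x y. h (g2mat x) (g2mat y) = plane_form q x y"
  shows "complexify_form (fundamental_form samelson_J h) [g2mat z, g2mat w]
    = plane_form (\<lambda>k. complex_of_real (q k)) (J_coords inv_sqrt3 z) w"
proof -
  let ?J = "J_coords (1 / sqrt 3)"
  have "complexify_form (fundamental_form samelson_J h) [g2mat z, g2mat w]
    = plane_form (\<lambda>k. complex_of_real (q k))
        (\<lambda>k. Complex (?J (\<lambda>k. Re (z k)) k) (?J (\<lambda>k. Im (z k)) k)) w"
    by (simp add: complexify_form_def map_matrix_g2mat fundamental_form_def samelson_J_g2mat assms
        plane_form_complexify)
  moreover have "Complex (?J (\<lambda>k. Re (z k)) k) (?J (\<lambda>k. Im (z k)) k) = J_coords inv_sqrt3 z k"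
    if "k \<in> {1..14}" for k
  proof -
    have "\<forall>k\<in>{1..14}. Complex (?J (\<lambda>k. Re (z k)) k) (?J (\<lambda>k. Im (z k)) k) = J_coords inv_sqrt3 z k"
      unfolding ball_1_14 J_coords_nth complex_eq_iff by simp
    then show ?thesis using that by blast
  qed
  ultimately show ?thesis by (simp add: plane_form_def)
qed

lemma trace_toral_g2mat:
  "trace (g2mat (\<lambda>i. if i = 1 then a else if i = 12 then b else 0) ** g2mat z)
    = - 2 * ((2 * a - b) * z 1 + (2 * b - a) * z 12)"
  unfolding trace_g2mat by (simp add: algebra_simps)

text \<open>Complex counterpart of \<open>gmetric_eq_trace\<close>, with \<open>K\<close> the
  complexified \<open>toral_elt\<close>. The factor \<open>- \<i>\<close> appears because the
  difference of the two projections is \<open>- \<i>\<close> times \<open>J\<close>.\<close>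

lemma gmetric_fundamental_form:
  fixes a1 a2 a3 :: real
  defines "K \<equiv> g2mat (\<lambda>i. if i = 1 then complex_of_real ((a3 - 3 * a2) / 48)
    else if i = 12 then complex_of_real ((3 * a2 + a3 - 2 * a1) / 48) else 0)"
  assumes X: "X \<in> range g2mat" and Y: "Y \<in> range g2mat"
  shows "complexify_form (fundamental_form samelson_J (gmetric a1 a2 a3)) [X, Y]
    = - \<i> * complex_of_real ((2 * a1 - 3 * a2 + a3) / 48)
        * (trace (proj10 samelson_J X ** Y) - trace (proj01 samelson_J X ** Y))
      + trace (K ** commutator X Y)"
proof -
  obtain z w where zw: "X = g2mat z" "Y = g2mat w" using X Y by blast
  let ?J = "J_coords inv_sqrt3 z"
  let ?m = "complex_of_real ((2 * a1 - 3 * a2 + a3) / 48)"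
  have "trace (proj10 samelson_J X ** Y) - trace (proj01 samelson_J X ** Y)
      = - \<i> * trace (g2mat ?J ** g2mat w)"
  proof -
    have "trace (proj10 samelson_J X ** Y) - trace (proj01 samelson_J X ** Y)
        = trace (g2mat (\<lambda>k. eigen_coords \<i> z k - eigen_coords (- \<i>) z k) ** g2mat w)"
      unfolding zw proj_g2mat g2mat_diff[symmetric] by (simp add: matrix_ring_simps)
    also have "(\<lambda>k. eigen_coords \<i> z k - eigen_coords (- \<i>) z k) = (\<lambda>k. - \<i> * ?J k)"
      by (rule ext) (simp add: eigen_coords_def flip: diff_divide_distrib)
    also have "trace (g2mat (\<lambda>k. - \<i> * ?J k) ** g2mat w) = - \<i> * trace (g2mat ?J ** g2mat w)"
      unfolding trace_g2mat by (simp only: algebra_simps)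
    finally show ?thesis .
  qed
  then have 1: "- \<i> * ?m * (trace (proj10 samelson_J X ** Y) - trace (proj01 samelson_J X ** Y))
      = - ?m * trace (g2mat ?J ** g2mat w)"
  proof (simp only:)
    show "- \<i> * m * (- \<i> * t) = - m * t" for m t :: complex
      by (simp add: complex_eq_iff)
  qed
  show ?thesis
    unfolding 1 unfolding zw complexify_fundamental_form[OF gmetric_g2mat] K_def commutator_g2mat
      trace_toral_g2mat trace_g2mat g2bracket_nth(1,12) J_coords_nth(2-11,13-14)
      plane_form_def gmetric_weights_nth
    by (simp add: algebra_simps add_divide_distrib diff_divide_distrib)
qed

lemma gmetric_pluriclosed:
  assumes "length Zs = 4" "set Zs \<subseteq> complexification (range g2mat)"
  shows "del samelson_J 1 2 (delbar samelson_J 1 1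
    (complexify_form (fundamental_form samelson_J (gmetric a1 a2 a3)))) Zs = 0"
proof -
  obtain A B C D where Zs: "Zs = [A, B, C, D]"
    using assms(1) by (auto simp: numeral_eq_Suc length_Suc_conv)
  have ii: "\<i> * \<i> = - 1" "(- \<i>) * (- \<i>) = - 1" by simp_all
  note eig = J_coords_eigen_coords[OF ii(1)] J_coords_eigen_coords[OF ii(2)]
  show ?thesis
    unfolding Zs
  proof (rule del_delbar_trace_form_eq_0[where L = "range g2mat"])
    show "A \<in> range g2mat" "B \<in> range g2mat" "C \<in> range g2mat" "D \<in> range g2mat"
      using assms(2) by (simp_all add: Zs complexification_g2)
    show "complexify_form (fundamental_form samelson_J (gmetric a1 a2 a3)) [X, Y] =
      - \<i> * complex_of_real ((2 * a1 - 3 * a2 + a3) / 48)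
        * (trace (proj10 samelson_J X ** Y) - trace (proj01 samelson_J X ** Y))
      + trace (g2mat (\<lambda>i. if i = 1 then complex_of_real ((a3 - 3 * a2) / 48)
    else if i = 12 then complex_of_real ((3 * a2 + a3 - 2 * a1) / 48) else 0) ** commutator X Y)"
      if "X \<in> range g2mat" "Y \<in> range g2mat" for X Y
      by (rule gmetric_fundamental_form[OF that])
    fix X Y :: "complex^7^7" assume "X \<in> range g2mat" "Y \<in> range g2mat"
    then obtain z w where zw: "X = g2mat z" "Y = g2mat w" by blast
    show "commutator X Y \<in> range g2mat"
      "proj10 samelson_J X \<in> range g2mat" "proj01 samelson_J X \<in> range g2mat"
      by (simp_all add: zw commutator_g2mat proj_g2mat)
    show "proj10 samelson_J X + proj01 samelson_J X = X"
      unfolding zw proj_g2mat g2mat_add g2mat_eq_iff by (simp add: eigen_coords_def flip: add_divide_distrib)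
    show "proj10 samelson_J (proj10 samelson_J X) = proj10 samelson_J X"
      "proj01 samelson_J (proj10 samelson_J X) = 0"
      "proj10 samelson_J (proj01 samelson_J X) = 0"
      "proj01 samelson_J (proj01 samelson_J X) = proj01 samelson_J X"
      unfolding zw proj_g2mat
      using eigen_coords_eigen[OF eig(1) ii(1)] eigen_coords_eigen[OF eig(2) ii(2)] by simp_all
    show "proj10 samelson_J (- X) = - proj10 samelson_J X" "proj01 samelson_J (- X) = - proj01 samelson_J X"
      unfolding zw g2mat_minus proj_g2mat g2mat_eq_iff ball_1_14 eigen_coords_def J_coords_nth
      by (simp_all add: field_simps)
    show "proj01 samelson_J (commutator (proj10 samelson_J X) (proj10 samelson_J Y)) = 0"
      "proj10 samelson_J (commutator (proj01 samelson_J X) (proj01 samelson_J Y)) = 0"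
      unfolding zw proj_g2mat commutator_g2mat
      using eigen_coords_eigen(2)[OF J_coords_g2bracket_eigen[OF eig(1) eig(1) ii(1)] ii(1)]
        eigen_coords_eigen(2)[OF J_coords_g2bracket_eigen[OF eig(2) eig(2) ii(2)] ii(2)] by simp_all
    show "trace (proj10 samelson_J X ** proj10 samelson_J Y) = 0"
      "trace (proj01 samelson_J X ** proj01 samelson_J Y) = 0"
      unfolding zw proj_g2mat
      using trace_eigen_coords_eq_0[OF eig(1) eig(1) ii(1)] trace_eigen_coords_eq_0[OF eig(2) eig(2) ii(2)]
      by simp_all
  qed
qed

section \<open>The pluriclosed equations\<close>

text \<open>Of the six bracket terms, the one with the bracket of \<open>Z\<close> and
  \<open>W\<close> drops out: it feeds two arguments of type (1,0) to a form of type (1,2). In the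
  others the types of the remaining arguments decide which projection of the bracket
  survives.\<close>

lemma del_delbar_2_2:
  fixes J :: "real^'n^'n \<Rightarrow> real^'n^'n" and L :: "(complex^'n^'n) set"
  defines "P \<equiv> proj10 J" and "Q \<equiv> proj01 J"
  defines "d \<equiv> \<lambda>\<alpha> X Y Z. ext_deriv \<alpha> [X, Y, Z]"
  assumes L: "0 \<in> L" "\<And>X Y. X \<in> L \<Longrightarrow> Y \<in> L \<Longrightarrow> commutator X Y \<in> L"
    "\<And>X. X \<in> L \<Longrightarrow> P X \<in> L" "\<And>X. X \<in> L \<Longrightarrow> Q X \<in> L"
    and PQ0: "P 0 = 0" "Q 0 = 0"
    and \<alpha>0: "\<And>X. X \<in> L \<Longrightarrow> \<alpha> [X, 0] = 0" "\<And>X. X \<in> L \<Longrightarrow> \<alpha> [0, X] = 0"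
    and XY: "X \<in> L" "Y \<in> L" "P X = X" "P Y = Y" "Q X = 0" "Q Y = 0"
    and ZW: "Z \<in> L" "W \<in> L" "P Z = 0" "P W = 0" "Q Z = Z" "Q W = W"
  shows "del J 1 2 (delbar J 1 1 \<alpha>) [X, Y, Z, W] =
    - d \<alpha> (P (commutator X Y)) Z W + d \<alpha> (Q (commutator X Z)) Y W
    - d \<alpha> (Q (commutator X W)) Y Z - d \<alpha> (Q (commutator Y Z)) X W
    + d \<alpha> (Q (commutator Y W)) X Z"
proof -
  have comm0: "commutator 0 V = 0" "commutator V 0 = 0" for V :: "complex^'n^'n"
    by (simp_all add: commutator_def matrix_matrix_mult_def vec_eq_iff)
  have d0: "ext_deriv \<alpha> [0, U, V] = 0" "ext_deriv \<alpha> [U, 0, V] = 0" "ext_deriv \<alpha> [U, V, 0] = 0"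
    if "U \<in> L" "V \<in> L" for U V
    using that by (simp_all add: ext_deriv_2_form comm0 \<alpha>0 L)
  have \<beta>: "delbar J 1 1 \<alpha> [U, V, T] = ext_deriv \<alpha> [P U, Q V, Q T] + ext_deriv \<alpha> [Q U, P V, Q T]
      + ext_deriv \<alpha> [Q U, Q V, P T]" for U V T
  proof -
    have "delbar J 1 1 \<alpha> [U, V, T] = type_part J 1 2 (ext_deriv \<alpha>) [U, V, T]"
      by (simp add: delbar_def)
    then show ?thesis
      by (simp only: type_part_1_2 P_def Q_def)
  qed
  have \<beta>0: "delbar J 1 1 \<alpha> [0, U, V] = 0" "delbar J 1 1 \<alpha> [U, 0, V] = 0" "delbar J 1 1 \<alpha> [U, V, 0] = 0"
    if "U \<in> L" "V \<in> L" for U V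
    using that by (simp_all add: \<beta> PQ0 d0 L)
  have d\<beta>0: "ext_deriv (delbar J 1 1 \<alpha>) [0, U, V, T] = 0" "ext_deriv (delbar J 1 1 \<alpha>) [U, 0, V, T] = 0"
    if "U \<in> L" "V \<in> L" "T \<in> L" for U V T
    using that by (simp_all add: ext_deriv_3_form comm0 \<beta>0 L)
  have "del J 1 2 (delbar J 1 1 \<alpha>) [X, Y, Z, W] = ext_deriv (delbar J 1 1 \<alpha>) [X, Y, Z, W]"
    unfolding del_def using XY ZW
    by (simp add: type_part_2_2 d\<beta>0 L(1) flip: P_def Q_def)
  also have "\<dots> = - d \<alpha> (P (commutator X Y)) Z W + d \<alpha> (Q (commutator X Z)) Y W
    - d \<alpha> (Q (commutator X W)) Y Z - d \<alpha> (Q (commutator Y Z)) X W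
    + d \<alpha> (Q (commutator Y W)) X Z"
    unfolding ext_deriv_3_form \<beta> d_def using XY ZW by (simp add: d0 L)
  finally show ?thesis .
qed

text \<open>The root vector \<open>J u + e u\<close> in the \<open>k\<close>-th root plane, of type \<open>(1, 0)\<close> for \<open>e = \<i>\<close> and
  of type \<open>(0, 1)\<close> for \<open>e = - \<i>\<close>, up to a scaling that makes the entries integral.\<close>
definition root_vec :: "complex \<Rightarrow> nat \<Rightarrow> nat \<Rightarrow> complex" where
  "root_vec e k = (\<lambda>i.
     [0, if i = 13 then e else if i = 14 then 1 else 0,
      if i = 4 then 2 * e else if i = 13 then e else if i = 2 then 2 else if i = 14 then 1 else 0,
      if i = 7 then e else if i = 3 then 1 else 0,
      if i = 8 then 2 * e else if i = 7 then - e else if i = 9 then 2 else if i = 3 then 1 else 0,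
      if i = 6 then e else if i = 5 then 1 else 0,
      if i = 10 then 2 * e else if i = 6 then - e else if i = 11 then 2 else if i = 5 then 1 else 0] ! k)"

definition toral_vec :: "complex \<Rightarrow> complex \<Rightarrow> nat \<Rightarrow> complex" where
  "toral_vec a b i = (if i = 1 then a else if i = 12 then b else 0)"

lemma root_vec_eigen:
  assumes "e * e = - 1" "k \<le> 6"
  shows "\<forall>i\<in>{1..14}. J_coords inv_sqrt3 (root_vec e k) i = e * root_vec e k i"
proof -
  have "\<forall>k\<in>{..6}. \<forall>i\<in>{1..14}. J_coords inv_sqrt3 (root_vec e k) i = e * root_vec e k i"
    unfolding ball_atMost_6 ball_1_14 J_coords_nth root_vec_def using assms(1) by simp
  then show ?thesis using assms(2) by blast
qed

lemma proj_root_vec: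
  assumes "k \<le> 6"
  shows "proj10 samelson_J (g2mat (root_vec \<i> k)) = g2mat (root_vec \<i> k)"
    "proj01 samelson_J (g2mat (root_vec \<i> k)) = 0"
    "proj10 samelson_J (g2mat (root_vec (- \<i>) k)) = 0"
    "proj01 samelson_J (g2mat (root_vec (- \<i>) k)) = g2mat (root_vec (- \<i>) k)"
proof -
  have i: "\<i> * \<i> = - 1" "(- \<i>) * (- \<i>) = - 1" by simp_all
  show "proj10 samelson_J (g2mat (root_vec \<i> k)) = g2mat (root_vec \<i> k)"
    "proj01 samelson_J (g2mat (root_vec \<i> k)) = 0"
    unfolding proj_g2mat using eigen_coords_eigen[OF root_vec_eigen[OF i(1) assms] i(1)] by simp_all
  show "proj10 samelson_J (g2mat (root_vec (- \<i>) k)) = 0"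
    "proj01 samelson_J (g2mat (root_vec (- \<i>) k)) = g2mat (root_vec (- \<i>) k)"
    unfolding proj_g2mat using eigen_coords_eigen[OF root_vec_eigen[OF i(2) assms] i(2)] by simp_all
qed

lemma proj_zero: "proj10 samelson_J 0 = 0" "proj01 samelson_J 0 = 0"
proof -
  have "g2mat (eigen_coords e (\<lambda>k. 0)) = 0" for e
    unfolding g2mat_0[symmetric] g2mat_eq_iff ball_1_14 eigen_coords_def J_coords_nth by simp
  then show "proj10 samelson_J 0 = 0" "proj01 samelson_J 0 = 0"
    unfolding g2mat_0[symmetric] proj_g2mat by (simp_all add: g2mat_0)
qed

text \<open>Exactly the brackets needed for the pairs of planes (3,5), (2,3), (4,5) and (2,4). Each
  is toral, zero, or a multiple of one root vector, whose type is read off from its sign of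
  \<open>\<i>\<close>.\<close>

lemma commutator_root_vec:
  "commutator (g2mat (root_vec \<i> 2)) (g2mat (root_vec (- \<i>) 2)) = g2mat (toral_vec (8 * \<i>) (4 * \<i>))"
  "commutator (g2mat (root_vec \<i> 3)) (g2mat (root_vec (- \<i>) 3)) = g2mat (toral_vec (4 * \<i>) 0)"
  "commutator (g2mat (root_vec \<i> 4)) (g2mat (root_vec (- \<i>) 4)) = g2mat (toral_vec (- 4 * \<i>) (- 8 * \<i>))"
  "commutator (g2mat (root_vec \<i> 5)) (g2mat (root_vec (- \<i>) 5)) = g2mat (toral_vec (4 * \<i>) (4 * \<i>))"
  "commutator (g2mat (root_vec \<i> 3)) (g2mat (root_vec \<i> 5)) = 0"
  "commutator (g2mat (root_vec \<i> 2)) (g2mat (root_vec \<i> 3)) = 0"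
  "commutator (g2mat (root_vec \<i> 4)) (g2mat (root_vec \<i> 5)) = g2mat (\<lambda>i. 2 * root_vec \<i> 2 i)"
  "commutator (g2mat (root_vec \<i> 2)) (g2mat (root_vec \<i> 4)) = g2mat (\<lambda>i. - (4 * root_vec \<i> 6 i))"
  "commutator (g2mat (root_vec \<i> 3)) (g2mat (root_vec (- \<i>) 5)) = g2mat (\<lambda>i. 2 * root_vec \<i> 1 i)"
  "commutator (g2mat (root_vec \<i> 5)) (g2mat (root_vec (- \<i>) 3)) = g2mat (\<lambda>i. - (2 * root_vec (- \<i>) 1 i))"
  "commutator (g2mat (root_vec \<i> 2)) (g2mat (root_vec (- \<i>) 3)) = g2mat (\<lambda>i. - (2 * root_vec (- \<i>) 6 i))"
  "commutator (g2mat (root_vec \<i> 3)) (g2mat (root_vec (- \<i>) 2)) = g2mat (\<lambda>i. 2 * root_vec \<i> 6 i)"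
  "commutator (g2mat (root_vec \<i> 4)) (g2mat (root_vec (- \<i>) 5)) = 0"
  "commutator (g2mat (root_vec \<i> 5)) (g2mat (root_vec (- \<i>) 4)) = 0"
  "commutator (g2mat (root_vec \<i> 2)) (g2mat (root_vec (- \<i>) 4)) = g2mat (\<lambda>i. 6 * root_vec \<i> 5 i)"
  "commutator (g2mat (root_vec \<i> 4)) (g2mat (root_vec (- \<i>) 2)) = g2mat (\<lambda>i. - (6 * root_vec (- \<i>) 5 i))"
  unfolding commutator_g2mat g2mat_0[symmetric] g2mat_eq_iff ball_1_14 g2bracket_nth
  by (simp_all add: root_vec_def toral_vec_def) (simp_all add: complex_eq_iff)

lemma zero_in_range_g2mat: "0 \<in> range g2mat"
  by (rule range_eqI[where x = "\<lambda>k. 0"]) (simp add: g2mat_0)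

lemma proj_in_range_g2mat:
  "proj10 samelson_J (g2mat z) \<in> range g2mat" "proj01 samelson_J (g2mat z) \<in> range g2mat"
  by (simp_all add: proj_g2mat)

lemma eigen_coords_scale: "g2mat (eigen_coords e (\<lambda>i. c * z i)) = g2mat (\<lambda>i. c * eigen_coords e z i)"
  unfolding g2mat_eq_iff ball_1_14 eigen_coords_def J_coords_nth by (simp add: field_simps)

lemma proj_scale_root_vec:
  assumes "k \<le> 6"
  shows "proj10 samelson_J (g2mat (\<lambda>i. c * root_vec \<i> k i)) = g2mat (\<lambda>i. c * root_vec \<i> k i)"
    "proj01 samelson_J (g2mat (\<lambda>i. c * root_vec \<i> k i)) = 0"
    "proj01 samelson_J (g2mat (\<lambda>i. c * root_vec (- \<i>) k i)) = g2mat (\<lambda>i. c * root_vec (- \<i>) k i)"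
    "proj10 samelson_J (g2mat (\<lambda>i. - (c * root_vec \<i> k i))) = g2mat (\<lambda>i. - (c * root_vec \<i> k i))"
    "proj01 samelson_J (g2mat (\<lambda>i. - (c * root_vec (- \<i>) k i))) = g2mat (\<lambda>i. - (c * root_vec (- \<i>) k i))"
  using proj_root_vec[OF assms]
  unfolding proj_g2mat mult_minus_left[symmetric] eigen_coords_scale
  unfolding g2mat_0[symmetric] g2mat_eq_iff by simp_all

text \<open>\<open>\<alpha>\<close> is the complexified fundamental form with undetermined weights
  \<open>q\<close>, so the pluriclosed condition becomes linear in \<open>q\<close>.\<close>

context
  fixes q :: "nat \<Rightarrow> real" and \<alpha> :: "7 cform"
  assumes \<alpha>: "\<And>z w. \<alpha> [g2mat z, g2mat w] = plane_form (\<lambda>k. complex_of_real (q k)) (J_coords inv_sqrt3 z) w"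
begin

lemma alpha_zero: "\<alpha> [g2mat z, 0] = 0" "\<alpha> [0, g2mat z] = 0"
  unfolding g2mat_0[symmetric] \<alpha> plane_form_def J_coords_nth by simp_all

lemma ext_deriv_alpha_zero: "ext_deriv \<alpha> [0, g2mat z, g2mat w] = 0"
proof -
  have "commutator 0 V = 0" for V :: "complex^7^7"
    by (simp add: commutator_def matrix_matrix_mult_def vec_eq_iff)
  then show ?thesis by (simp add: ext_deriv_2_form alpha_zero commutator_g2mat)
qed

lemma del_delbar_alpha:
  assumes "k \<le> 6" "l \<le> 6"
  shows "del samelson_J 1 2 (delbar samelson_J 1 1 \<alpha>)
      [g2mat (root_vec \<i> k), g2mat (root_vec \<i> l), g2mat (root_vec (- \<i>) k), g2mat (root_vec (- \<i>) l)]
    = - ext_deriv \<alpha> [proj10 samelson_J (commutator (g2mat (root_vec \<i> k)) (g2mat (root_vec \<i> l))),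
          g2mat (root_vec (- \<i>) k), g2mat (root_vec (- \<i>) l)]
      + ext_deriv \<alpha> [proj01 samelson_J (commutator (g2mat (root_vec \<i> k)) (g2mat (root_vec (- \<i>) k))),
          g2mat (root_vec \<i> l), g2mat (root_vec (- \<i>) l)]
      - ext_deriv \<alpha> [proj01 samelson_J (commutator (g2mat (root_vec \<i> k)) (g2mat (root_vec (- \<i>) l))),
          g2mat (root_vec \<i> l), g2mat (root_vec (- \<i>) k)]
      - ext_deriv \<alpha> [proj01 samelson_J (commutator (g2mat (root_vec \<i> l)) (g2mat (root_vec (- \<i>) k))),
          g2mat (root_vec \<i> k), g2mat (root_vec (- \<i>) l)]
      + ext_deriv \<alpha> [proj01 samelson_J (commutator (g2mat (root_vec \<i> l)) (g2mat (root_vec (- \<i>) l))),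
          g2mat (root_vec \<i> k), g2mat (root_vec (- \<i>) k)]"
  by (rule del_delbar_2_2[where L = "range g2mat"])
    (auto simp: proj_root_vec[OF assms(1)] proj_root_vec[OF assms(2)] proj_zero alpha_zero
      commutator_g2mat proj_in_range_g2mat zero_in_range_g2mat)

lemma ext_deriv_alpha_toral:
  assumes "commutator (g2mat (root_vec \<i> k)) (g2mat (root_vec (- \<i>) k)) = g2mat (toral_vec a b)"
    and "k \<le> 6"
  shows "ext_deriv \<alpha> [proj01 samelson_J (g2mat (toral_vec c d)),
      g2mat (root_vec \<i> k), g2mat (root_vec (- \<i>) k)]
    = - complex_of_real (q 0) / 2 * (3 / 2 * inv_sqrt3 * (b * c - a * d) + \<i> * (a * c + b * d - (a * d + b * c) / 2))"
proof -
  define c' where "c' = (c + \<i> * (inv_sqrt3 * (2 * d - c))) / 2"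
  define d' where "d' = (d + \<i> * (inv_sqrt3 * (d - 2 * c))) / 2"
  let ?t = "g2mat (toral_vec c' d')"
  have t: "proj01 samelson_J (g2mat (toral_vec c d)) = ?t"
    unfolding proj_g2mat g2mat_eq_iff ball_1_14 eigen_coords_def J_coords_nth
    by (simp add: toral_vec_def c'_def d'_def)
  \<comment> \<open>The torus acts on the two conjugate root vectors by opposite scalars and
    \<open>\<alpha>\<close> is alternating on them; hence these terms cancel and only the weight
    \<open>q 0\<close> remains.\<close>
  have "\<forall>k\<in>{..6}. \<alpha> [commutator ?t (g2mat (root_vec \<i> k)), g2mat (root_vec (- \<i>) k)]
      = \<alpha> [commutator ?t (g2mat (root_vec (- \<i>) k)), g2mat (root_vec \<i> k)]"
    unfolding ball_atMost_6 commutator_g2mat \<alpha> plane_form_def J_coords_nth g2bracket_nth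
    by (simp add: toral_vec_def root_vec_def algebra_simps)
  then have "ext_deriv \<alpha> [?t, g2mat (root_vec \<i> k), g2mat (root_vec (- \<i>) k)]
      = - \<alpha> [g2mat (toral_vec a b), ?t]"
    using assms(2) by (simp add: ext_deriv_2_form assms(1))
  also have "\<dots> = - (complex_of_real (q 0) * (3 / 2 * (inv_sqrt3 * (b * c' - a * d'))))"
    unfolding \<alpha> plane_form_def J_coords_nth by (simp add: toral_vec_def field_simps)
  also have "inv_sqrt3 * (b * c' - a * d') = (inv_sqrt3 * (b * c - a * d)
      + \<i> * (inv_sqrt3 * (inv_sqrt3 * (b * (2 * d - c) - a * (d - 2 * c))))) / 2"
    unfolding c'_def d'_def by (simp add: field_simps)
  also have "- (complex_of_real (q 0) * (3 / 2 * ((inv_sqrt3 * (b * c - a * d)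
      + \<i> * (inv_sqrt3 * (inv_sqrt3 * (b * (2 * d - c) - a * (d - 2 * c))))) / 2)))
    = - complex_of_real (q 0) / 2 * (3 / 2 * inv_sqrt3 * (b * c - a * d)
        + \<i> * (a * c + b * d - (a * d + b * c) / 2))"
    unfolding inv_sqrt3_sq by (simp add: field_simps del: of_real_divide)
  finally show ?thesis unfolding t .
qed

text \<open>One quadruple of root vectors per relation. The \<open>inv_sqrt3\<close> parts of the
  two toral terms change sign when the planes are exchanged, so they cancel; the relation is then
  read off from the imaginary part.\<close>

lemma pluriclosed_weights:
  assumes "\<And>Zs. length Zs = 4 \<Longrightarrow> set Zs \<subseteq> range g2mat \<Longrightarrow>
    del samelson_J 1 2 (delbar samelson_J 1 1 \<alpha>) Zs = 0"
  shows "q 1 = q 0 + q 3 - q 5"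
    "3 * q 0 + 3 * q 3 = 4 * q 2 + 4 * q 6"
    "3 * q 0 + 4 * q 2 = 4 * q 4 + 3 * q 5"
    "3 * q 0 + 9 * q 5 + 16 * q 6 = 28 * q 2 + 4 * q 4"
proof -
  have "del samelson_J 1 2 (delbar samelson_J 1 1 \<alpha>)
      [g2mat (root_vec \<i> 3), g2mat (root_vec \<i> 5), g2mat (root_vec (- \<i>) 3), g2mat (root_vec (- \<i>) 5)] = 0"
    by (rule assms) simp_all
  then show "q 1 = q 0 + q 3 - q 5"
    by (simp add: del_delbar_alpha commutator_root_vec proj_scale_root_vec proj_root_vec proj_zero
        ext_deriv_alpha_zero ext_deriv_alpha_toral[OF commutator_root_vec(2)] ext_deriv_alpha_toral[OF commutator_root_vec(4)] del: of_real_divide)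
      (drule arg_cong[where f = Im], simp add: ext_deriv_2_form commutator_g2mat \<alpha> plane_form_def
        J_coords_nth g2bracket_nth root_vec_def)
  have "del samelson_J 1 2 (delbar samelson_J 1 1 \<alpha>)
      [g2mat (root_vec \<i> 2), g2mat (root_vec \<i> 3), g2mat (root_vec (- \<i>) 2), g2mat (root_vec (- \<i>) 3)] = 0"
    by (rule assms) simp_all
  then show "3 * q 0 + 3 * q 3 = 4 * q 2 + 4 * q 6"
    by (simp add: del_delbar_alpha commutator_root_vec proj_scale_root_vec proj_root_vec proj_zero
        ext_deriv_alpha_zero ext_deriv_alpha_toral[OF commutator_root_vec(1)] ext_deriv_alpha_toral[OF commutator_root_vec(2)] del: of_real_divide)
      (drule arg_cong[where f = Im], simp add: ext_deriv_2_form commutator_g2mat \<alpha> plane_form_def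
        J_coords_nth g2bracket_nth root_vec_def)
  have "del samelson_J 1 2 (delbar samelson_J 1 1 \<alpha>)
      [g2mat (root_vec \<i> 4), g2mat (root_vec \<i> 5), g2mat (root_vec (- \<i>) 4), g2mat (root_vec (- \<i>) 5)] = 0"
    by (rule assms) simp_all
  then show "3 * q 0 + 4 * q 2 = 4 * q 4 + 3 * q 5"
    by (simp add: del_delbar_alpha commutator_root_vec proj_scale_root_vec proj_root_vec proj_zero
        ext_deriv_alpha_zero ext_deriv_alpha_toral[OF commutator_root_vec(3)] ext_deriv_alpha_toral[OF commutator_root_vec(4)] del: of_real_divide)
      (drule arg_cong[where f = Im], simp add: ext_deriv_2_form commutator_g2mat \<alpha> plane_form_def
        J_coords_nth g2bracket_nth root_vec_def)
  have "del samelson_J 1 2 (delbar samelson_J 1 1 \<alpha>)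
      [g2mat (root_vec \<i> 2), g2mat (root_vec \<i> 4), g2mat (root_vec (- \<i>) 2), g2mat (root_vec (- \<i>) 4)] = 0"
    by (rule assms) simp_all
  then show "3 * q 0 + 9 * q 5 + 16 * q 6 = 28 * q 2 + 4 * q 4"
    by (simp add: del_delbar_alpha commutator_root_vec proj_scale_root_vec proj_root_vec proj_zero
        ext_deriv_alpha_zero ext_deriv_alpha_toral[OF commutator_root_vec(1)] ext_deriv_alpha_toral[OF commutator_root_vec(3)] del: of_real_divide)
      (drule arg_cong[where f = Im], simp add: ext_deriv_2_form commutator_g2mat \<alpha> plane_form_def
        J_coords_nth g2bracket_nth root_vec_def)
qed

end

section \<open>Positivity and comparison of weights\<close>

lemma plane_form_cong:
  assumes "\<And>k. k \<le> 6 \<Longrightarrow> q k = q' k"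
  shows "plane_form q x y = plane_form q' x y"
  using assms by (simp add: plane_form_def)

lemma plane_form_pos:
  fixes x :: "nat \<Rightarrow> real"
  assumes q: "\<And>k. k \<le> 6 \<Longrightarrow> q k > 0" and x: "g2mat x \<noteq> 0"
  shows "plane_form q x x > 0"
proof (rule ccontr)
  assume neg: "\<not> plane_form q x x > 0"
  have q': "q 0 > 0" "q 1 > 0" "q 2 > 0" "q 3 > 0" "q 4 > 0" "q 5 > 0" "q 6 > 0"
    by (simp_all add: q)
  \<comment> \<open>The quadratic form is a weighted sum of squares; the toral entry is x^2 - x y +
    y^2 with the square completed.\<close>
  define t where "t = (\<lambda>k. [(x 1 - x 12 / 2)\<^sup>2 + 3 * (x 12 / 2)\<^sup>2,
    (x 13 - x 4 / 2)\<^sup>2 + (x 14 - x 2 / 2)\<^sup>2, (x 4)\<^sup>2 + (x 2)\<^sup>2,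
    (x 7 + x 8 / 2)\<^sup>2 + (x 3 - x 9 / 2)\<^sup>2, (x 8)\<^sup>2 + (x 9)\<^sup>2,
    (x 6 + x 10 / 2)\<^sup>2 + (x 5 - x 11 / 2)\<^sup>2, (x 10)\<^sup>2 + (x 11)\<^sup>2] ! k)"
  have t: "\<forall>k\<in>{..6}. t k \<ge> 0"
    unfolding ball_atMost_6 by (simp add: t_def)
  have "plane_form q x x = (\<Sum>k\<le>6. q k * t k)"
    unfolding sum_atMost_6 plane_form_def
    by (simp add: t_def power2_eq_square algebra_simps add_divide_distrib diff_divide_distrib)
  moreover have "(\<Sum>k\<le>6. q k * t k) \<ge> 0"
    using t q by (intro sum_nonneg mult_nonneg_nonneg) (auto intro: less_imp_le)
  ultimately have "(\<Sum>k\<le>6. q k * t k) = 0" using neg by simp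
  then have "\<forall>k\<in>{..6}. q k * t k = 0"
    using t q by (subst (asm) sum_nonneg_eq_0_iff) (auto intro!: mult_nonneg_nonneg intro: less_imp_le)
  then have "\<forall>k\<in>{..6}. t k = 0" unfolding ball_atMost_6 using q' by simp
  then have "\<forall>k\<in>{1..14}. x k = 0"
    unfolding ball_atMost_6 ball_1_14 by (simp add: t_def sum_power2_eq_zero_iff add_nonneg_eq_0_iff)
  then have "g2mat x = g2mat (\<lambda>k. 0)" unfolding g2mat_eq_iff by simp
  then show False using x by (simp add: g2mat_0)
qed

lemma plane_form_J:
  "plane_form q (J_coords (1 / sqrt 3) x) (J_coords (1 / sqrt 3) y) = plane_form q x y"
proof -
  have 0: "(1 / sqrt 3 * a) * (1 / sqrt 3 * b) = a * b / 3" for a b :: real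
    by simp
  show ?thesis
    unfolding plane_form_def J_coords_nth 0 by (simp add: field_simps)
qed

lemma gmetric_weights_pos:
  assumes "admissible a1 a2 a3" "k \<le> 6"
  shows "gmetric_weights a1 a2 a3 k > 0"
proof -
  have "\<forall>k\<in>{..6}. gmetric_weights a1 a2 a3 k > 0"
    unfolding ball_atMost_6 gmetric_weights_nth using assms(1) by (simp add: admissible_def)
  then show ?thesis using assms(2) by simp
qed

lemma hermitian_gmetric:
  assumes "admissible a1 a2 a3"
  shows "hermitian_metric_on (range g2mat) samelson_J (gmetric a1 a2 a3)"
proof -
  let ?q = "gmetric_weights a1 a2 a3"
  have "bilinear_form_on (range g2mat) (gmetric a1 a2 a3)"
    unfolding bilinear_form_on_def
    by (auto simp: g2mat_add g2mat_scaleR gmetric_g2mat plane_form_def algebra_simps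
        add_divide_distrib diff_divide_distrib)
  moreover have "gmetric a1 a2 a3 (g2mat x) (g2mat y) = gmetric a1 a2 a3 (g2mat y) (g2mat x)" for x y
    unfolding gmetric_g2mat plane_form_def by (simp only: mult.commute[of "x _"] add.commute[of "x 1 * y 12"])
      (simp add: algebra_simps)
  moreover have "gmetric a1 a2 a3 (g2mat x) (g2mat x) > 0" if "g2mat x \<noteq> 0" for x
    unfolding gmetric_g2mat by (rule plane_form_pos[OF gmetric_weights_pos[OF assms] that])
  moreover have "gmetric a1 a2 a3 (samelson_J (g2mat x)) (samelson_J (g2mat y)) = gmetric a1 a2 a3 (g2mat x) (g2mat y)" for x y
    unfolding samelson_J_g2mat gmetric_g2mat plane_form_J ..
  ultimately show ?thesis
    unfolding hermitian_metric_on_def inner_product_on_def by blast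
qed

lemma skt_gmetric:
  assumes "admissible a1 a2 a3"
  shows "skt_on (range g2mat) samelson_J (gmetric a1 a2 a3)"
  unfolding skt_on_def using hermitian_gmetric[OF assms] gmetric_pluriclosed by simp

lemma right_invariant_gmetric:
  assumes T: "torus T" "T \<subseteq> G2" and bas: "bas 1 \<in> lie_algebra T" "bas 12 \<in> lie_algebra T"
  shows "right_invariant_under G2 T (left_invariant_metric (gmetric a1 a2 a3))"
  unfolding right_invariant_under_def
proof (intro ballI)
  fix A F U V
  assume A: "A \<in> T" and F: "F \<in> G2" and U: "U \<in> tangent_space G2 F" and V: "V \<in> tangent_space G2 F"
  have AG: "A \<in> G2" using A T(2) by (rule rev_subsetD)
  note iA = G2_inverse[OF AG] and iF = G2_inverse[OF F]
  have "matrix_inv (F ** A) = matrix_inv A ** matrix_inv F"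
  proof (rule matrix_inv_unique)
    have "F ** A ** (matrix_inv A ** matrix_inv F) = F ** (A ** matrix_inv A) ** matrix_inv F"
      by (simp only: matrix_mul_assoc)
    then show "F ** A ** (matrix_inv A ** matrix_inv F) = mat 1"
      by (simp add: iA iF)
    have "matrix_inv A ** matrix_inv F ** (F ** A) = matrix_inv A ** (matrix_inv F ** F) ** A"
      by (simp only: matrix_mul_assoc)
    then show "matrix_inv A ** matrix_inv F ** (F ** A) = mat 1"
      by (simp add: iA iF)
  qed
  \<comment> \<open>In the left trivialization, right translation by \<open>A\<close> is
    conjugation, at every point \<open>F\<close>.\<close>
  then have eq: "matrix_inv (F ** A) ** (W ** A) = matrix_inv A ** (matrix_inv F ** W) ** A" for W
    by (simp only: matrix_mul_assoc)
  show "left_invariant_metric (gmetric a1 a2 a3) (F ** A) (U ** A) (V ** A)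
      = left_invariant_metric (gmetric a1 a2 a3) F U V"
    unfolding left_invariant_metric_def eq
    by (rule gmetric_adjoint[OF AG torus_commute_lie_algebra[OF T(1) A bas(1)]
          torus_commute_lie_algebra[OF T(1) A bas(2)] G2_tangent_space_left[OF F U]
          G2_tangent_space_left[OF F V]])
qed

lemma gmetric_eq_killing_form_iff:
  "(\<forall>X\<in>range g2mat. \<forall>Y\<in>range g2mat. gmetric a1 a2 a3 X Y = - lam * killing_form X Y) \<longleftrightarrow>
    a1 = 96 * lam \<and> a2 = 32 * lam \<and> a3 = 96 * lam"
proof
  assume "\<forall>X\<in>range g2mat. \<forall>Y\<in>range g2mat. gmetric a1 a2 a3 X Y = - lam * killing_form X Y"
  then have *: "plane_form (gmetric_weights a1 a2 a3) x x = - lam * (4 * trace (g2mat x ** g2mat x))" for x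
    by (simp add: gmetric_g2mat killing_form_g2mat)
  show "a1 = 96 * lam \<and> a2 = 32 * lam \<and> a3 = 96 * lam"
    \<comment> \<open>These vectors test the weights 0, 3 and 1, three independent linear functions
      of the parameters.\<close>
    using *[of "\<lambda>i. if i = 1 then 1 else 0"] *[of "\<lambda>i. if i = 3 then 1 else 0"]
      *[of "\<lambda>i. if i = 13 then 1 else 0"]
    unfolding trace_g2mat plane_form_def gmetric_weights_nth by simp
next
  assume a: "a1 = 96 * lam \<and> a2 = 32 * lam \<and> a3 = 96 * lam"
  have "plane_form (gmetric_weights a1 a2 a3) x y = - lam * (4 * trace (g2mat x ** g2mat y))" for x y
    unfolding trace_g2mat plane_form_def gmetric_weights_nth
    using a by (simp add: algebra_simps)
  then show "\<forall>X\<in>range g2mat. \<forall>Y\<in>range g2mat. gmetric a1 a2 a3 X Y = - lam * killing_form X Y"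
    by (auto simp: gmetric_g2mat killing_form_g2mat)
qed

lemma invariant_skt_eq_gmetric:
  assumes T: "torus T" "T \<subseteq> G2" and reg: "regular_elt \<in> lie_algebra T"
    and skt: "skt_on (range g2mat) samelson_J h"
    and inv: "right_invariant_under G2 T (left_invariant_metric h)"
  shows "\<exists>a1 a2 a3. admissible a1 a2 a3 \<and>
    (\<forall>X\<in>range g2mat. \<forall>Y\<in>range g2mat. h X Y = gmetric a1 a2 a3 X Y)"
proof -
  let ?q = "metric_weight h"
  have herm: "hermitian_metric_on (range g2mat) samelson_J h"
    using skt by (simp add: skt_on_def)
  then have bil: "bilinear_form_on (range g2mat) h" and pos: "\<And>X. X \<in> range g2mat \<Longrightarrow> X \<noteq> 0 \<Longrightarrow> h X X > 0"
    unfolding hermitian_metric_on_def inner_product_on_def by simp_all blast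
  have h: "h (g2mat x) (g2mat y) = plane_form ?q x y" for x y
    by (rule invariant_hermitian_eq_plane_form[OF herm right_invariant_imp_ad_skew[OF T reg bil inv]])
  have "\<forall>k\<in>{..6}. g2mat (plane_vec k) \<noteq> 0"
    unfolding ball_atMost_6 g2mat_0[symmetric] g2mat_eq_iff ball_1_14 by (simp add: plane_vec_def)
  then have q_pos: "\<forall>k\<in>{..6}. ?q k > 0"
    using pos unfolding metric_weight_def by simp
  \<comment> \<open>Inverts the formulas for the weights 2, 3 and 4, each of which involves a single
    parameter; the four relations determine the other weights.\<close>
  define a1 a2 a3 where "a1 = 8 * ?q 2" and "a2 = 2 * ?q 3" and "a3 = 8 * ?q 4"
  have eqs: "?q 1 = ?q 0 + ?q 3 - ?q 5" "3 * ?q 0 + 3 * ?q 3 = 4 * ?q 2 + 4 * ?q 6"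
    "3 * ?q 0 + 4 * ?q 2 = 4 * ?q 4 + 3 * ?q 5" "3 * ?q 0 + 9 * ?q 5 + 16 * ?q 6 = 28 * ?q 2 + 4 * ?q 4"
    using pluriclosed_weights[OF complexify_fundamental_form[OF h]] skt
    unfolding skt_on_def complexification_g2 by simp_all
  have "\<forall>k\<in>{..6}. ?q k = gmetric_weights a1 a2 a3 k"
    unfolding ball_atMost_6 gmetric_weights_nth a1_def a2_def a3_def using eqs by (intro conjI) (simp_all add: field_simps)
  then have "h X Y = gmetric a1 a2 a3 X Y" if "X \<in> range g2mat" "Y \<in> range g2mat" for X Y
    using that by (auto simp: h gmetric_g2mat intro!: plane_form_cong)
  moreover have "admissible a1 a2 a3"
    \<comment> \<open>The bounds on \<open>a3\<close> are positivity of weights 0, 1, 4 and 5, while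
      \<open>a2 < a1\<close> follows because weights 0 and 5 add up to
      \<open>(a1 - a2) / 2\<close>.\<close>
    unfolding admissible_def a1_def a2_def a3_def
    using q_pos[unfolded ball_atMost_6] eqs by simp
  ultimately show ?thesis by blast
qed

theorem theorem4p11:
  fixes T :: "(real^7^7) set"
  assumes "maximal_torus G2 T"
    and "lie_algebra T = span {bas 1, bas 12}"
  shows
    "(\<forall>a1 a2 a3. admissible a1 a2 a3 \<longrightarrow>
        skt_on (lie_algebra G2) samelson_J (gmetric a1 a2 a3) \<and>
        right_invariant_under G2 T (left_invariant_metric (gmetric a1 a2 a3)) \<and>
        (\<forall>lam>0.
           (\<forall>X\<in>lie_algebra G2. \<forall>Y\<in>lie_algebra G2.
              gmetric a1 a2 a3 X Y = - lam * killing_form X Y) \<longleftrightarrow>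
           a1 = 96 * lam \<and> a2 = 32 * lam \<and> a3 = 96 * lam)) \<and>
     (\<forall>h. skt_on (lie_algebra G2) samelson_J h \<and>
           right_invariant_under G2 T (left_invariant_metric h) \<longrightarrow>
        (\<exists>a1 a2 a3. admissible a1 a2 a3 \<and>
           (\<forall>X\<in>lie_algebra G2. \<forall>Y\<in>lie_algebra G2. h X Y = gmetric a1 a2 a3 X Y)))"
proof -
  have T: "torus T" "T \<subseteq> G2" using assms(1) by (simp_all add: maximal_torus_def)
  have bas: "bas 1 \<in> lie_algebra T" "bas 12 \<in> lie_algebra T"
    unfolding assms(2) by (simp_all add: span_base)
  have reg: "regular_elt \<in> lie_algebra T"
    unfolding assms(2) regular_elt_def by (intro span_add span_scale span_base) simp_all
  show ?thesis
    unfolding lie_algebra_G2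
    using skt_gmetric right_invariant_gmetric[OF T bas] gmetric_eq_killing_form_iff
      invariant_skt_eq_gmetric[OF T reg] by simp
qed

end
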